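(* Assume $\tilde\omega_i=\omega_i$ for all $i=1,\dots,s$ and that the diagonally implicit IMEX--RK method (S) is of third order. Then the additive Runge--Kutta method consisting of (S), (A) and the update ($\tilde{\mathrm A}$), as a discretization of the extended system (E), is of third order, provided that $$\sum_{i=1}^s\frac{d_i^2}{\omega_i}=\frac13,\qquad \sum_{i=1}^s\frac{e_i^2}{\omega_i}=\frac13\qquad\text{and}\qquad \sum_{i=1}^s\frac{d_i\,e_i}{\omega_i}=\frac13 .$$
   Context: Let $f,g:\mathbb{R}^K\times\mathbb{R}^m\to\mathbb{R}^K$ be sufficiently smooth, with Jacobians $f_y,g_y$ in $y$. Real coefficients $\tilde a_{ij},a_{ij}$ and weights $\tilde\omega_i\ne0$, $\omega_i\neq0$ ($i,j=1,\dots,s$) are given. The method is diagonally implicit IMEX--RK: $\tilde a_{ij}=0$ for $j\ge i$ and $a_{ij}=0$ for $j>i$. (S): $Y_n^{(i)}=y_n+h\sum_{j}\tilde a_{ij}f(Y_n^{(j)},u_n^j)+h\sum_{j}a_{ij}g(Y_n^{(j)},u_n^j)$ ($i=1,\dots,s$), $\;y_{n+1}=y_n+h\sum_i\tilde\omega_if(Y_n^{(i)},u_n^i)+h\sum_i\omega_ig(Y_n^{(i)},u_n^i)$. (A): for $i=1,\dots,s$, $$\tilde P_n^{(i)}=p_n-h\sum_{j}\tilde\alpha_{ij}f_y(Y_n^{(j)},u_n^j)^T\tilde P_n^{(j)}-h\sum_{j}\alpha_{ij}g_y(Y_n^{(j)},u_n^j)^TP_n^{(j)},$$ $$P_n^{(i)}=p_n-h\sum_{j}\tilde\beta_{ij}f_y(Y_n^{(j)},u_n^j)^T\tilde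 P_n^{(j)}-h\sum_{j}\beta_{ij}g_y(Y_n^{(j)},u_n^j)^TP_n^{(j)},$$ $$p_{n+1}=p_n-h\sum_{i}\tilde\omega_if_y(Y_n^{(i)},u_n^i)^T\tilde P_n^{(i)}-h\sum_{i}\omega_ig_y(Y_n^{(i)},u_n^i)^TP_n^{(i)},$$ with $\tilde\alpha_{ij}=\tilde\omega_j-\frac{\tilde\omega_j}{\tilde\omega_i}\tilde a_{ji}$, $\alpha_{ij}=\omega_j-\frac{\omega_j}{\tilde\omega_i}\tilde a_{ji}$, $\tilde\beta_{ij}=\tilde\omega_j-\frac{\tilde\omega_j}{\omega_i}a_{ji}$, $\beta_{ij}=\omega_j-\frac{\omega_j}{\omega_i}a_{ji}$. ($\tilde{\mathrm A}$): $\tilde p_{n+1}=\tilde p_n-h\sum_i\tilde\omega_if_y(Y_n^{(i)},u_n^i)^T\tilde P_n^{(i)}-h\sum_i\omega_ig_y(Y_n^{(i)},u_n^i)^TP_n^{(i)}$, where $\tilde p$ and $p$ carry the same data, so $\tilde p_n=p_n$. (E): $\dot y=f(y,u)+g(y,u)$, $\;\dot{\tilde p}=-f_y(y,u)^T\tilde p-g_y(y,u)^Tp$, $\;\dot p=-f_y(y,u)^T\tilde p-g_y(y,u)^Tp$. Here the control is eliminated by a smooth function $u=\tilde\varphi(y,p,\tilde p)$, and correspondingly $u_n^i=\tilde\varphi(Y_n^{(i)},P_n^{(i)},\tilde P_n^{(i)})$, so that (E) is an autonomous, fully coupled system. Coefficients: $d_j=\sum_{i=1}^s\omega_i\tilde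 a_{ij}$, $\; e_j=\sum_{i=1}^s\omega_ia_{ij}$. Order: the IMEX--RK method (S) is of order $r$ if, for every system $\dot y=F(y)+G(y)$ with smooth $F,G$ (in any dimension), the method $Y^{(i)}=y_n+h\sum_j\tilde a_{ij}F(Y^{(j)})+h\sum_ja_{ij}G(Y^{(j)})$, $y_{n+1}=y_n+h\sum_i\tilde\omega_iF(Y^{(i)})+h\sum_i\omega_iG(Y^{(i)})$ has local error $y_{n+1}-y(t_n+h)=O(h^{r+1})$ as $h\to0$ when $y(t_n)=y_n$. The additive method (S), (A), ($\tilde{\mathrm A}$) is of order $r$ if, for all smooth $f,g,\tilde\varphi$, the one-step local error in each of $y,\tilde p,p$ is $O(h^{r+1})$ when started from exact data $y(t_n)=y_n$, $\tilde p(t_n)=p(t_n)=p_n=\tilde p_n$ of (E). *)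

theory Defs
  imports "HOL-Analysis.Analysis" "HOL-Library.Landau_Symbols"
begin

text \<open>
  Conventions. Stages are numbered \<open>1, \<dots>, s\<close>. The coefficients with a tilde (explicit part, field
  \<open>f\<close> resp. \<open>F\<close>) are \<open>ta\<close>, \<open>tw\<close>; those without (implicit part, field \<open>g\<close> resp. \<open>G\<close>) are
  \<open>a\<close>, \<open>w\<close>. ``Smooth'' means infinitely often continuously differentiable. Step sizes are
  positive, so \<open>h \<rightarrow> 0\<close> is the filter \<open>at_right 0\<close>.
\<close>

definition diagonally_implicit ::
  "nat \<Rightarrow> (nat \<Rightarrow> nat \<Rightarrow> real) \<Rightarrow> (nat \<Rightarrow> nat \<Rightarrow> real) \<Rightarrow> bool" where
  "diagonally_implicit s ta a \<longleftrightarrow>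
     (\<forall>i\<in>{1..s}. \<forall>j\<in>{1..s}. (j \<ge> i \<longrightarrow> ta i j = 0) \<and> (j > i \<longrightarrow> a i j = 0))"

text \<open>
  The order of the IMEX method quantifies over systems of every dimension, so the dimension has to
  be a natural number here: \<open>\<real>\<^sup>N\<close> is the carrier of \<^const>\<open>Euclidean_space\<close>, i.e. the set of all
  \<open>x :: nat \<Rightarrow> real\<close> with \<open>x k = 0\<close> for \<open>k \<ge> N\<close>. As this type carries no normed structure,
  differentiability is expressed by partial derivatives.
\<close>

abbreviation RN :: "nat \<Rightarrow> (nat \<Rightarrow> real) set" where
  "RN N \<equiv> topspace (Euclidean_space N)"

primrec coord_Ck :: "nat \<Rightarrow> nat \<Rightarrow> ((nat \<Rightarrow> real) \<Rightarrow> real) \<Rightarrow> bool" where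
  "coord_Ck N 0 \<phi> \<longleftrightarrow> continuous_map (Euclidean_space N) euclideanreal \<phi>"
| "coord_Ck N (Suc n) \<phi> \<longleftrightarrow> continuous_map (Euclidean_space N) euclideanreal \<phi> \<and>
     (\<forall>i<N. \<exists>\<psi>. coord_Ck N n \<psi> \<and>
        (\<forall>x\<in>RN N. ((\<lambda>\<xi>. \<phi> (x(i := \<xi>))) has_real_derivative \<psi> x) (at (x i))))"

definition smooth_field :: "nat \<Rightarrow> ((nat \<Rightarrow> real) \<Rightarrow> (nat \<Rightarrow> real)) \<Rightarrow> bool" where
  "smooth_field N F \<longleftrightarrow> F \<in> RN N \<rightarrow> RN N \<and> (\<forall>k<N. \<forall>n. coord_Ck N n (\<lambda>x. F x k))"

definition imex_stages ::
  "nat \<Rightarrow> (nat \<Rightarrow> nat \<Rightarrow> real) \<Rightarrow> (nat \<Rightarrow> nat \<Rightarrow> real) \<Rightarrow> nat \<Rightarrow>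
   ((nat \<Rightarrow> real) \<Rightarrow> (nat \<Rightarrow> real)) \<Rightarrow> ((nat \<Rightarrow> real) \<Rightarrow> (nat \<Rightarrow> real)) \<Rightarrow>
   real \<Rightarrow> (nat \<Rightarrow> real) \<Rightarrow> (nat \<Rightarrow> (nat \<Rightarrow> real)) \<Rightarrow> bool" where
  "imex_stages s ta a N F G h y0 Y \<longleftrightarrow>
     (\<forall>i\<in>{1..s}. Y i \<in> RN N \<and>
        (\<forall>k<N. Y i k = y0 k + h * (\<Sum>j=1..s. ta i j * F (Y j) k)
                            + h * (\<Sum>j=1..s. a i j * G (Y j) k)))"

text \<open>
  The stage equations are implicit. By the implicit function theorem they have, for small \<open>h\<close>,
  exactly one solution near the initial value; further solutions of a nonlinear system may run off
  to infinity as \<open>h \<rightarrow> 0\<close> and are not what the method computes. The requirement that the stages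
  tend to the initial value selects the right branch.
\<close>

definition imex_order ::
  "nat \<Rightarrow> (nat \<Rightarrow> nat \<Rightarrow> real) \<Rightarrow> (nat \<Rightarrow> nat \<Rightarrow> real) \<Rightarrow> (nat \<Rightarrow> real) \<Rightarrow> (nat \<Rightarrow> real) \<Rightarrow> nat \<Rightarrow> bool"
where
  "imex_order s ta a tw w r \<longleftrightarrow>
     (\<forall>N F G (t0::real) (\<epsilon>::real) (y :: real \<Rightarrow> nat \<Rightarrow> real) (Y :: real \<Rightarrow> nat \<Rightarrow> nat \<Rightarrow> real).
        smooth_field N F \<and> smooth_field N G \<and>
        \<epsilon> > 0 \<and>
        (\<forall>t\<in>ball t0 \<epsilon>. y t \<in> RN N \<and>
           (\<forall>k<N. ((\<lambda>\<tau>. y \<tau> k) has_real_derivative F (y t) k + G (y t) k) (at t))) \<and>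
        (\<forall>\<^sub>F h in at_right 0. imex_stages s ta a N F G h (y t0) (Y h)) \<and>
        (\<forall>i\<in>{1..s}. \<forall>k<N. ((\<lambda>h. Y h i k) \<longlongrightarrow> y t0 k) (at_right 0))
        \<longrightarrow>
        (\<forall>k<N. (\<lambda>h. (y t0 k + h * (\<Sum>i=1..s. tw i * F (Y h i) k)
                             + h * (\<Sum>i=1..s. w i * G (Y h i) k)) - y (t0 + h) k)
                 \<in> O[at_right 0](\<lambda>h. h ^ Suc r)))"

definition alpha_t :: "(nat \<Rightarrow> nat \<Rightarrow> real) \<Rightarrow> (nat \<Rightarrow> real) \<Rightarrow> nat \<Rightarrow> nat \<Rightarrow> real" where
  "alpha_t ta tw i j = tw j - tw j / tw i * ta j i"

definition alpha ::
  "(nat \<Rightarrow> nat \<Rightarrow> real) \<Rightarrow> (nat \<Rightarrow> real) \<Rightarrow> (nat \<Rightarrow> real) \<Rightarrow> nat \<Rightarrow> nat \<Rightarrow> real" where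
  "alpha ta tw w i j = w j - w j / tw i * ta j i"

definition beta_t ::
  "(nat \<Rightarrow> nat \<Rightarrow> real) \<Rightarrow> (nat \<Rightarrow> real) \<Rightarrow> (nat \<Rightarrow> real) \<Rightarrow> nat \<Rightarrow> nat \<Rightarrow> real" where
  "beta_t a tw w i j = tw j - tw j / w i * a j i"

definition beta :: "(nat \<Rightarrow> nat \<Rightarrow> real) \<Rightarrow> (nat \<Rightarrow> real) \<Rightarrow> nat \<Rightarrow> nat \<Rightarrow> real" where
  "beta a w i j = w j - w j / w i * a j i"

definition coeff_d :: "nat \<Rightarrow> (nat \<Rightarrow> nat \<Rightarrow> real) \<Rightarrow> (nat \<Rightarrow> real) \<Rightarrow> nat \<Rightarrow> real" where
  "coeff_d s ta w j = (\<Sum>i=1..s. w i * ta i j)"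

definition coeff_e :: "nat \<Rightarrow> (nat \<Rightarrow> nat \<Rightarrow> real) \<Rightarrow> (nat \<Rightarrow> real) \<Rightarrow> nat \<Rightarrow> real" where
  "coeff_e s a w j = (\<Sum>i=1..s. w i * a i j)"

text \<open>
  The extended system lives in \<open>\<real>\<^sup>K\<close> and \<open>\<real>\<^sup>m\<close> with \<open>K\<close> and \<open>m\<close> fixed, hence the types
  \<open>real ^ 'k\<close> and \<open>real ^ 'm\<close>.
\<close>

primrec Ck :: "nat \<Rightarrow> ('a::euclidean_space \<Rightarrow> 'b::euclidean_space) \<Rightarrow> bool" where
  "Ck 0 f \<longleftrightarrow> continuous_on UNIV f"
| "Ck (Suc n) f \<longleftrightarrow> (\<forall>x. f differentiable (at x)) \<and> (\<forall>v. Ck n (\<lambda>x. frechet_derivative f (at x) v))"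

definition smooth :: "('a::euclidean_space \<Rightarrow> 'b::euclidean_space) \<Rightarrow> bool" where
  "smooth f \<longleftrightarrow> (\<forall>n. Ck n f)"

text \<open>\<open>jacT f y u P\<close> is \<open>f\<^sub>y(y, u)\<^sup>T P\<close>.\<close>

definition jacT ::
  "((real ^ 'k) \<times> (real ^ 'm) \<Rightarrow> real ^ 'k) \<Rightarrow> real ^ 'k \<Rightarrow> real ^ 'm \<Rightarrow> real ^ 'k \<Rightarrow> real ^ 'k" where
  "jacT f y u P = transpose (jacobian (\<lambda>\<eta>. f (\<eta>, u)) (at y)) *v P"

text \<open>The eliminated control is \<open>u = \<phi>(y, p, tp)\<close>, with this order of the arguments.\<close>

definition extended_solution ::
  "((real ^ 'k) \<times> (real ^ 'm) \<Rightarrow> real ^ 'k) \<Rightarrow> ((real ^ 'k) \<times> (real ^ 'm) \<Rightarrow> real ^ 'k) \<Rightarrow>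
   ((real ^ 'k) \<times> (real ^ 'k) \<times> (real ^ 'k) \<Rightarrow> real ^ 'm) \<Rightarrow> real set \<Rightarrow>
   (real \<Rightarrow> real ^ 'k) \<Rightarrow> (real \<Rightarrow> real ^ 'k) \<Rightarrow> (real \<Rightarrow> real ^ 'k) \<Rightarrow> bool" where
  "extended_solution f g \<phi> T y tp p \<longleftrightarrow>
     (\<forall>t\<in>T. let u = \<phi> (y t, p t, tp t) in
        (y has_vector_derivative f (y t, u) + g (y t, u)) (at t) \<and>
        (tp has_vector_derivative - jacT f (y t) u (tp t) - jacT g (y t) u (p t)) (at t) \<and>
        (p has_vector_derivative - jacT f (y t) u (tp t) - jacT g (y t) u (p t)) (at t))"

definition additive_stages ::
  "nat \<Rightarrow> (nat \<Rightarrow> nat \<Rightarrow> real) \<Rightarrow> (nat \<Rightarrow> nat \<Rightarrow> real) \<Rightarrow> (nat \<Rightarrow> real) \<Rightarrow> (nat \<Rightarrow> real) \<Rightarrow>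
   ((real ^ 'k) \<times> (real ^ 'm) \<Rightarrow> real ^ 'k) \<Rightarrow> ((real ^ 'k) \<times> (real ^ 'm) \<Rightarrow> real ^ 'k) \<Rightarrow>
   ((real ^ 'k) \<times> (real ^ 'k) \<times> (real ^ 'k) \<Rightarrow> real ^ 'm) \<Rightarrow> real \<Rightarrow> real ^ 'k \<Rightarrow> real ^ 'k \<Rightarrow>
   (nat \<Rightarrow> real ^ 'k) \<Rightarrow> (nat \<Rightarrow> real ^ 'k) \<Rightarrow> (nat \<Rightarrow> real ^ 'k) \<Rightarrow> bool" where
  "additive_stages s ta a tw w f g \<phi> h y0 p0 Y tP P \<longleftrightarrow>
     (let U = (\<lambda>j. \<phi> (Y j, P j, tP j)) in
      \<forall>i\<in>{1..s}.
        Y i = y0 + h *\<^sub>R (\<Sum>j=1..s. ta i j *\<^sub>R f (Y j, U j))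
                 + h *\<^sub>R (\<Sum>j=1..s. a i j *\<^sub>R g (Y j, U j)) \<and>
        tP i = p0 - h *\<^sub>R (\<Sum>j=1..s. alpha_t ta tw i j *\<^sub>R jacT f (Y j) (U j) (tP j))
                  - h *\<^sub>R (\<Sum>j=1..s. alpha ta tw w i j *\<^sub>R jacT g (Y j) (U j) (P j)) \<and>
        P i = p0 - h *\<^sub>R (\<Sum>j=1..s. beta_t a tw w i j *\<^sub>R jacT f (Y j) (U j) (tP j))
                 - h *\<^sub>R (\<Sum>j=1..s. beta a w i j *\<^sub>R jacT g (Y j) (U j) (P j)))"

definition state_update ::
  "nat \<Rightarrow> (nat \<Rightarrow> real) \<Rightarrow> (nat \<Rightarrow> real) \<Rightarrow>
   ((real ^ 'k) \<times> (real ^ 'm) \<Rightarrow> real ^ 'k) \<Rightarrow> ((real ^ 'k) \<times> (real ^ 'm) \<Rightarrow> real ^ 'k) \<Rightarrow>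
   ((real ^ 'k) \<times> (real ^ 'k) \<times> (real ^ 'k) \<Rightarrow> real ^ 'm) \<Rightarrow> real \<Rightarrow> real ^ 'k \<Rightarrow>
   (nat \<Rightarrow> real ^ 'k) \<Rightarrow> (nat \<Rightarrow> real ^ 'k) \<Rightarrow> (nat \<Rightarrow> real ^ 'k) \<Rightarrow> real ^ 'k" where
  "state_update s tw w f g \<phi> h y0 Y tP P =
     (let U = (\<lambda>i. \<phi> (Y i, P i, tP i)) in
      y0 + h *\<^sub>R (\<Sum>i=1..s. tw i *\<^sub>R f (Y i, U i)) + h *\<^sub>R (\<Sum>i=1..s. w i *\<^sub>R g (Y i, U i)))"

text \<open>The updates of \<open>p\<close> and of \<open>tp\<close> use the same increment and hence the same function,
  applied to \<open>q0 = p0\<close> and to \<open>q0 = tp0\<close>.\<close>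

definition costate_update ::
  "nat \<Rightarrow> (nat \<Rightarrow> real) \<Rightarrow> (nat \<Rightarrow> real) \<Rightarrow>
   ((real ^ 'k) \<times> (real ^ 'm) \<Rightarrow> real ^ 'k) \<Rightarrow> ((real ^ 'k) \<times> (real ^ 'm) \<Rightarrow> real ^ 'k) \<Rightarrow>
   ((real ^ 'k) \<times> (real ^ 'k) \<times> (real ^ 'k) \<Rightarrow> real ^ 'm) \<Rightarrow> real \<Rightarrow> real ^ 'k \<Rightarrow>
   (nat \<Rightarrow> real ^ 'k) \<Rightarrow> (nat \<Rightarrow> real ^ 'k) \<Rightarrow> (nat \<Rightarrow> real ^ 'k) \<Rightarrow> real ^ 'k" where
  "costate_update s tw w f g \<phi> h q0 Y tP P =
     (let U = (\<lambda>i. \<phi> (Y i, P i, tP i)) in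
      q0 - h *\<^sub>R (\<Sum>i=1..s. tw i *\<^sub>R jacT f (Y i) (U i) (tP i))
         - h *\<^sub>R (\<Sum>i=1..s. w i *\<^sub>R jacT g (Y i) (U i) (P i)))"

text \<open>The first two arguments only fix \<open>K = CARD('k)\<close> and \<open>m = CARD('m)\<close>. The limit conditions on
  the stages play the same role as in \<^const>\<open>imex_order\<close>.\<close>

definition additive_order ::
  "'k::finite itself \<Rightarrow> 'm::finite itself \<Rightarrow>
   nat \<Rightarrow> (nat \<Rightarrow> nat \<Rightarrow> real) \<Rightarrow> (nat \<Rightarrow> nat \<Rightarrow> real) \<Rightarrow> (nat \<Rightarrow> real) \<Rightarrow> (nat \<Rightarrow> real) \<Rightarrow> nat \<Rightarrow> bool"
where
  "additive_order K m s ta a tw w r \<longleftrightarrow>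
     (\<forall>(f :: (real ^ 'k) \<times> (real ^ 'm) \<Rightarrow> real ^ 'k) (g :: (real ^ 'k) \<times> (real ^ 'm) \<Rightarrow> real ^ 'k)
       (\<phi> :: (real ^ 'k) \<times> (real ^ 'k) \<times> (real ^ 'k) \<Rightarrow> real ^ 'm)
       (t0::real) (\<epsilon>::real) (y :: real \<Rightarrow> real ^ 'k) (tp :: real \<Rightarrow> real ^ 'k) (p :: real \<Rightarrow> real ^ 'k)
       (Y :: real \<Rightarrow> nat \<Rightarrow> real ^ 'k) (tP :: real \<Rightarrow> nat \<Rightarrow> real ^ 'k) (P :: real \<Rightarrow> nat \<Rightarrow> real ^ 'k).
        smooth f \<and> smooth g \<and> smooth \<phi> \<and>
        \<epsilon> > 0 \<and> extended_solution f g \<phi> (ball t0 \<epsilon>) y tp p \<and> tp t0 = p t0 \<and>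
        (\<forall>\<^sub>F h in at_right 0.
           additive_stages s ta a tw w f g \<phi> h (y t0) (p t0) (Y h) (tP h) (P h)) \<and>
        (\<forall>i\<in>{1..s}. ((\<lambda>h. Y h i) \<longlongrightarrow> y t0) (at_right 0) \<and>
                    ((\<lambda>h. tP h i) \<longlongrightarrow> p t0) (at_right 0) \<and>
                    ((\<lambda>h. P h i) \<longlongrightarrow> p t0) (at_right 0))
        \<longrightarrow>
        (\<lambda>h. norm (state_update s tw w f g \<phi> h (y t0) (Y h) (tP h) (P h) - y (t0 + h)))
          \<in> O[at_right 0](\<lambda>h. h ^ Suc r) \<and>
        (\<lambda>h. norm (costate_update s tw w f g \<phi> h (tp t0) (Y h) (tP h) (P h) - tp (t0 + h)))
          \<in> O[at_right 0](\<lambda>h. h ^ Suc r) \<and>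
        (\<lambda>h. norm (costate_update s tw w f g \<phi> h (p t0) (Y h) (tP h) (P h) - p (t0 + h)))
          \<in> O[at_right 0](\<lambda>h. h ^ Suc r))"

end

theory Submission
  imports Defs
begin

text \<open>
  For equal weights the scheme is an additive Runge-Kutta method with four parts and common weights
  \<open>w\<close>: the matrices \<open>ta\<close>, \<open>a\<close> act on \<open>f\<close>, \<open>g\<close>, and their adjoints \<open>w\<^sub>j - (w\<^sub>j / w\<^sub>i) A\<^sub>j\<^sub>i\<close> act on the
  equations for \<open>tp\<close> and \<open>p\<close>. Third order amounts to
  \<open>\<Sum> w\<^sub>i = 1\<close>, \<open>\<Sum> w\<^sub>i c\<^sub>i = 1/2\<close>, \<open>\<Sum> w\<^sub>i c\<^sub>i c'\<^sub>i = 1/3\<close> and \<open>\<Sum> w\<^sub>i A\<^sub>i\<^sub>j c'\<^sub>j = 1/6\<close> for all parts, where the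
  \<open>c\<close> are row sums. The conditions that involve only \<open>ta\<close> and \<open>a\<close> are read off from the order of the
  IMEX method on a polynomial system whose components realise these elementary differentials. The
  row sums of the adjoint matrices are \<open>1 - d\<^sub>i / w\<^sub>i\<close> and \<open>1 - e\<^sub>i / w\<^sub>i\<close>, so the remaining conditions
  follow from the former together with the three hypotheses on \<open>d\<close> and \<open>e\<close>. Sufficiency of the
  conditions comes from comparing the expansions of the numerical and the exact solution in powers
  of \<open>h\<close>.
\<close>

section \<open>Smooth functions and their Taylor polynomials\<close>

lemma Ck_SucI:
  assumes "\<And>x. (f has_derivative f' x) (at x)" and "\<And>v. Ck n (\<lambda>x. f' x v)"
  shows "Ck (Suc n) f"
proof -
  have "frechet_derivative f (at x) = f' x" for x
    using frechet_derivative_at[OF assms(1)] by simp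
  then show ?thesis using assms by (auto simp: differentiable_def)
qed

lemma Ck_SucD:
  assumes "Ck (Suc n) f"
  shows "(f has_derivative frechet_derivative f (at x)) (at x)"
    and "Ck n (\<lambda>x. frechet_derivative f (at x) v)"
  using assms frechet_derivative_works by auto

lemma Ck_Suc_imp: "Ck (Suc n) f \<Longrightarrow> Ck n f"
proof (induction n arbitrary: f)
  case 0
  then show ?case
    by (auto intro!: continuous_at_imp_continuous_on differentiable_imp_continuous_within)
next
  case (Suc n)
  show ?case
    using Suc.IH[OF Ck_SucD(2)[OF Suc.prems]] Ck_SucD(1)[OF Suc.prems]
    by (intro Ck_SucI)
qed

lemma Ck_const: "Ck n (\<lambda>x. c)"
proof (induction n arbitrary: c)
  case (Suc n)
  then show ?case by (intro Ck_SucI[where f' = "\<lambda>_ _. 0"]) auto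
qed simp

lemma Ck_linear:
  assumes "bounded_linear f"
  shows "Ck n f"
proof (cases n)
  case 0
  then show ?thesis using assms by (simp add: linear_continuous_on)
next
  case (Suc m)
  show ?thesis
    unfolding Suc by (rule Ck_SucI[OF bounded_linear_imp_has_derivative[OF assms] Ck_const])
qed

lemma Ck_add: "Ck n f \<Longrightarrow> Ck n g \<Longrightarrow> Ck n (\<lambda>x. f x + g x)"
proof (induction n arbitrary: f g)
  case (Suc n)
  show ?case
    by (rule Ck_SucI[OF has_derivative_add[OF Ck_SucD(1)[OF Suc.prems(1)] Ck_SucD(1)[OF Suc.prems(2)]]])
      (intro Suc.IH Ck_SucD(2)[OF Suc.prems(1)] Ck_SucD(2)[OF Suc.prems(2)])
qed (simp add: continuous_on_add)

lemma Ck_sum: "(\<And>i. i \<in> I \<Longrightarrow> Ck n (f i)) \<Longrightarrow> Ck n (\<lambda>x. \<Sum>i\<in>I. f i x)"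
  by (induction I rule: infinite_finite_induct) (auto intro: Ck_const Ck_add)

text \<open>Each term of the product rule keeps one factor undifferentiated. That factor is moved to
  the lower class by \<open>Ck_Suc_imp\<close>, after which the induction hypothesis covers both
  terms.\<close>

lemma Ck_bilinear:
  assumes "bounded_bilinear B"
  shows "Ck n f \<Longrightarrow> Ck n g \<Longrightarrow> Ck n (\<lambda>x. B (f x) (g x))"
proof (induction n arbitrary: f g)
  case 0
  then show ?case by (simp add: bounded_bilinear.continuous_on[OF assms])
next
  case (Suc n)
  note D = Ck_SucD[OF Suc.prems(1)] Ck_SucD[OF Suc.prems(2)]
  show ?case
    by (rule Ck_SucI[OF bounded_bilinear.FDERIV[OF assms D(1) D(3)]])
      (intro Ck_add Suc.IH Ck_Suc_imp[OF Suc.prems(1)] Ck_Suc_imp[OF Suc.prems(2)] D(2,4))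
qed

lemma has_derivative_sum_Basis:
  fixes f :: "'a::euclidean_space \<Rightarrow> 'b::real_normed_vector"
  assumes "(f has_derivative f') (at x)"
  shows "f' v = (\<Sum>b\<in>Basis. (v \<bullet> b) *\<^sub>R f' b)"
proof -
  have lin: "linear f'" using assms has_derivative_linear by blast
  from linear_sum[OF this, of "\<lambda>b. (v \<bullet> b) *\<^sub>R b" Basis] show ?thesis
    by (simp add: euclidean_representation linear_cmul[OF lin])
qed

text \<open>In the chain rule the direction in which \<open>f\<close> is differentiated varies with
  the point, whereas \<open>Ck\<close> speaks about fixed directions. Expanding the direction in
  \<open>Basis\<close> gives a finite sum of scalar coefficients times derivatives of
  \<open>f\<close> in basis directions composed with \<open>g\<close>, and the induction hypothesis
  applies to these.\<close>

lemma Ck_compose: "Ck n f \<Longrightarrow> Ck n g \<Longrightarrow> Ck n (\<lambda>x. f (g x))"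
proof (induction n arbitrary: f g)
  case 0
  then show ?case by (auto intro: continuous_on_compose2)
next
  case (Suc n)
  note Df = Ck_SucD[OF Suc.prems(1)] and Dg = Ck_SucD[OF Suc.prems(2)]
  let ?f' = "\<lambda>x. frechet_derivative f (at x)" and ?g' = "\<lambda>x. frechet_derivative g (at x)"
  have "?f' (g x) (?g' x v) = (\<Sum>b\<in>Basis. (?g' x v \<bullet> b) *\<^sub>R ?f' (g x) b)" for x v
    by (rule has_derivative_sum_Basis[OF Df(1)])
  moreover have "((\<lambda>x. f (g x)) has_derivative (\<lambda>v. ?f' (g x) (?g' x v))) (at x)" for x
    using diff_chain_at[OF Dg(1) Df(1)] by (simp add: o_def)
  moreover have "Ck n (\<lambda>x. \<Sum>b\<in>Basis. (?g' x v \<bullet> b) *\<^sub>R ?f' (g x) b)" for v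
    by (intro Ck_sum Ck_bilinear[OF bounded_bilinear_scaleR] Suc.IH
        Ck_bilinear[OF bounded_bilinear_inner] Dg(2) Df(2) Ck_const Ck_Suc_imp[OF Suc.prems(2)])
  ultimately show ?case by (intro Ck_SucI) auto
qed

lemma Ck_Pair:
  assumes "Ck n f" "Ck n g"
  shows "Ck n (\<lambda>x. (f x, g x))"
proof -
  have "Ck n (\<lambda>x. (f x, 0) + (0, g x))"
    by (intro Ck_add Ck_compose[OF Ck_linear assms(1)] Ck_compose[OF Ck_linear assms(2)]
        bounded_linear_Pair bounded_linear_ident bounded_linear_zero)
  then show ?thesis by simp
qed

section \<open>Landau calculus for functions with values in normed spaces\<close>

definition vbigo :: "'x filter \<Rightarrow> ('x \<Rightarrow> real) \<Rightarrow> ('x \<Rightarrow> 'a::real_normed_vector) \<Rightarrow> bool" where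
  "vbigo F g r \<longleftrightarrow> (\<lambda>x. norm (r x)) \<in> O[F](g)"

lemma vbigo_le:
  assumes "vbigo F g r" "\<And>x. norm (r' x) \<le> C * norm (r x)"
  shows "vbigo F g r'"
proof -
  have "(\<lambda>x. norm (r' x)) \<in> O[F](\<lambda>x. norm (r x))"
    using assms(2) by (intro bigoI[where c = C]) (auto intro!: always_eventually)
  then show ?thesis using assms(1) landau_o.big_trans unfolding vbigo_def by blast
qed

lemma vbigo_zero: "vbigo F g (\<lambda>x. 0)"
  by (simp add: vbigo_def)

lemma vbigo_add:
  assumes "vbigo F g r" "vbigo F g r'"
  shows "vbigo F g (\<lambda>x. r x + r' x)"
proof -
  have "vbigo F g (\<lambda>x. norm (r x) + norm (r' x))"
    using sum_in_bigo(1)[OF assms[unfolded vbigo_def]] by (simp add: vbigo_def)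
  then show ?thesis
    by (rule vbigo_le[where C = 1]) (auto intro: order_trans[OF norm_triangle_ineq])
qed

lemma vbigo_linear: "bounded_linear L \<Longrightarrow> vbigo F g r \<Longrightarrow> vbigo F g (\<lambda>x. L (r x))"
  by (rule vbigo_le[where C = "onorm L"]) (auto intro: onorm)

lemma vbigo_diff: "vbigo F g r \<Longrightarrow> vbigo F g r' \<Longrightarrow> vbigo F g (\<lambda>x. r x - r' x)"
  using vbigo_add[of F g r "\<lambda>x. - r' x"]
  by (simp add: vbigo_def)

lemma vbigo_sum: "(\<And>i. i \<in> I \<Longrightarrow> vbigo F g (r i)) \<Longrightarrow> vbigo F g (\<lambda>x. \<Sum>i\<in>I. r i x)"
  by (induction I rule: infinite_finite_induct) (auto intro: vbigo_zero vbigo_add)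

lemma vbigo_bilinear:
  assumes "bounded_bilinear B" "vbigo F g r" "vbigo F g' r'"
  shows "vbigo F (\<lambda>x. g x * g' x) (\<lambda>x. B (r x) (r' x))"
proof -
  obtain K where K: "\<And>a b. norm (B a b) \<le> norm a * norm b * K"
    using bounded_bilinear.bounded[OF assms(1)] by blast
  have "vbigo F (\<lambda>x. g x * g' x) (\<lambda>x. norm (r x) * norm (r' x))"
    using landau_o.big.mult[OF assms(2,3)[unfolded vbigo_def]] by (simp add: vbigo_def abs_mult)
  then show ?thesis
    by (rule vbigo_le[where C = K]) (use K in \<open>auto simp: abs_mult mult_ac\<close>)
qed

lemma vbigo_mono: "vbigo F g r \<Longrightarrow> g \<in> O[F](g') \<Longrightarrow> vbigo F g' r"
  unfolding vbigo_def by (rule landau_o.big_trans)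

lemma vbigo_cong_ev:
  assumes "eventually (\<lambda>x. r x = r' x) F" "vbigo F g r"
  shows "vbigo F g r'"
proof -
  have "eventually (\<lambda>x. norm (r x) = norm (r' x)) F"
    using assms(1) by eventually_elim simp
  from landau_o.big.in_cong[OF this] show ?thesis using assms(2) unfolding vbigo_def by blast
qed

text \<open>Carries a remainder estimate in the space variable over to a curve \<open>X\<close>;
  with \<open>F\<close> the neighbourhoods of 0 and \<open>G\<close> the limit of vanishing step
  size, Taylor remainders become powers of the step size.\<close>

lemma vbigo_compose:
  assumes "vbigo F (\<lambda>x. norm x ^ n) r" "filterlim X F G" "vbigo G g X"
  shows "vbigo G (\<lambda>h. g h ^ n) (\<lambda>h. r (X h))"
proof -
  have "(\<lambda>h. norm (r (X h))) \<in> O[G](\<lambda>h. norm (X h) ^ n)"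
    using landau_o.big.compose[OF assms(1)[unfolded vbigo_def] assms(2)] .
  also have "(\<lambda>h. norm (X h) ^ n) \<in> O[G](\<lambda>h. g h ^ n)"
    using assms(3) unfolding vbigo_def by (rule landau_o.big_power)
  finally show ?thesis unfolding vbigo_def .
qed

text \<open>Only derivatives in the radial direction are needed, so the symmetry of the second derivative
  plays no role below.\<close>

lemma vbigo_integrate_ray:
  fixes R :: "'a::real_normed_vector \<Rightarrow> 'b::real_inner"
  assumes "R 0 = 0" "\<And>x. (R has_derivative R' x) (at x)"
    and "vbigo (nhds 0) (\<lambda>x. norm x ^ Suc n) (\<lambda>x. R' x x)"
  shows "vbigo (nhds 0) (\<lambda>x. norm x ^ Suc n) R"
proof -
  obtain C where C: "C > 0" and ev: "eventually (\<lambda>x. norm (R' x x) \<le> C * norm x ^ Suc n) (nhds 0)"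
    using assms(3) unfolding vbigo_def bigo_def by auto
  then obtain d where d: "d > 0" "\<And>x. norm x < d \<Longrightarrow> norm (R' x x) \<le> C * norm x ^ Suc n"
    unfolding eventually_nhds_metric by auto
  have "norm (R x) \<le> C * norm x ^ Suc n" if x: "norm x < d" for x
  proof -
    have der: "((\<lambda>t. R (t *\<^sub>R x)) has_derivative (\<lambda>u. R' (t *\<^sub>R x) (u *\<^sub>R x))) (at t)" for t
      using diff_chain_at[OF bounded_linear_imp_has_derivative[OF bounded_linear_scaleR_left] assms(2)]
      by (simp add: o_def)
    then have "continuous_on {0..1} (\<lambda>t. R (t *\<^sub>R x))"
      by (intro continuous_at_imp_continuous_on ballI has_derivative_continuous)
    from mvt_general[OF _ this der]
    obtain t where t: "0 < t" "t < 1" "norm (R (1 *\<^sub>R x) - R (0 *\<^sub>R x)) \<le> norm (R' (t *\<^sub>R x) ((1 - 0) *\<^sub>R x))"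
      by auto
    have lin: "linear (R' (t *\<^sub>R x))" using assms(2) has_derivative_linear by blast
    \<comment> \<open>The mean value theorem differentiates at \<open>t\<close> times
      \<open>x\<close> in direction \<open>x\<close>, while the hypothesis needs \<open>t\<close>
      times \<open>x\<close> as direction as well. Linearity supplies this factor \<open>t\<close>,
      and it cancels against one of the \<open>Suc n\<close> factors on the right.\<close>
    have "t * norm (R' (t *\<^sub>R x) x) = norm (R' (t *\<^sub>R x) (t *\<^sub>R x))"
      using t by (simp add: linear_cmul[OF lin])
    also have "\<dots> \<le> C * norm (t *\<^sub>R x) ^ Suc n"
    proof (rule d(2))
      have "t * norm x \<le> norm x" using t by (simp add: mult_left_le_one_le)
      then show "norm (t *\<^sub>R x) < d" using x t by simp
    qed
    also have "\<dots> = t * (t ^ n * (C * norm x ^ Suc n))" using t by (simp add: power_mult_distrib)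
    finally have "norm (R' (t *\<^sub>R x) x) \<le> t ^ n * (C * norm x ^ Suc n)" using t by simp
    also have "\<dots> \<le> C * norm x ^ Suc n"
      using t C by (intro mult_left_le_one_le power_le_one) auto
    finally show ?thesis using t assms(1) by simp
  qed
  then have "eventually (\<lambda>x. norm (R x) \<le> C * norm x ^ Suc n) (nhds 0)"
    unfolding eventually_nhds_metric using d(1) by auto
  then show ?thesis unfolding vbigo_def by (intro bigoI[where c = C]) (simp add: eventually_mono)
qed

section \<open>Taylor estimates with Landau remainders\<close>

lemma has_derivative_vbigo:
  fixes f :: "'a::real_normed_vector \<Rightarrow> 'b::real_normed_vector"
  assumes "(f has_derivative f') (at x)"
  shows "vbigo (nhds 0) norm (\<lambda>v. f (x + v) - f x)"
proof -
  have bl: "bounded_linear f'" using assms has_derivative_bounded_linear by blast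
  obtain d where d: "d > 0" "\<And>y. norm (y - x) < d \<Longrightarrow> norm (f y - f x - f' (y - x)) \<le> 1 * norm (y - x)"
    using assms unfolding has_derivative_at_alt by (meson zero_less_one)
  have "norm (f (x + v) - f x) \<le> (1 + onorm f') * norm v" if "norm v < d" for v
    using d(2)[of "x + v"] that onorm[OF bl, of v] norm_triangle_sub[of "f (x + v) - f x" "f' v"]
    by (simp add: algebra_simps)
  then have "eventually (\<lambda>v. norm (f (x + v) - f x) \<le> (1 + onorm f') * norm v) (nhds 0)"
    unfolding eventually_nhds_metric using d(1) by auto
  then show ?thesis unfolding vbigo_def by (intro bigoI[where c = "1 + onorm f'"]) (simp add: eventually_mono)
qed

lemma vbigo_inner_const: "vbigo F norm (\<lambda>x. x \<bullet> b)"
  unfolding vbigo_def by (intro bigoI[where c = "norm b"]) (auto intro!: always_eventually simp: Cauchy_Schwarz_ineq2 mult.commute)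

text \<open>The radial derivative of the remainder is a sum of coordinates of \<open>x\<close> times
  increments of partial derivatives. Both factors are O(|x|), the second because the partial
  derivatives are differentiable again, and integration along rays keeps the power 2.\<close>

lemma Ck_taylor1:
  fixes f :: "'a::euclidean_space \<Rightarrow> 'b::euclidean_space"
  assumes "Ck 2 f"
  shows "vbigo (nhds 0) (\<lambda>x. norm x ^ 2) (\<lambda>x. f (z + x) - f z - frechet_derivative f (at z) x)"
proof -
  let ?f' = "\<lambda>x. frechet_derivative f (at x)"
  have C: "Ck (Suc (Suc 0)) f" using assms by (simp only: numeral_2_eq_2)
  note D = Ck_SucD[OF C]
  let ?R = "\<lambda>x. f (z + x) - f z - ?f' z x" and ?R' = "\<lambda>x v. ?f' (z + x) v - ?f' z v"
  have bl: "bounded_linear (?f' z)" using D(1) has_derivative_bounded_linear by blast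
  have der: "(?R has_derivative ?R' x) (at x)" for x
  proof -
    have "((\<lambda>x. f (z + x)) has_derivative (\<lambda>v. ?f' (z + x) v)) (at x)"
      by (rule has_derivative_compose[where f = "\<lambda>x. z + x" and g = f, OF _ D(1)])
        (auto intro!: derivative_eq_intros)
    from has_derivative_diff[OF has_derivative_diff[OF this has_derivative_const]
        bounded_linear_imp_has_derivative[OF bl]]
    show ?thesis by simp
  qed
  have "?R' x x = (\<Sum>b\<in>Basis. (x \<bullet> b) *\<^sub>R (?f' (z + x) b - ?f' z b))" for x
    using has_derivative_sum_Basis[OF D(1), of z x] has_derivative_sum_Basis[OF D(1), of "z + x" x]
    by (simp add: scaleR_diff_right sum_subtractf)
  moreover have "vbigo (nhds 0) (\<lambda>x. norm x * norm x)
      (\<lambda>x. \<Sum>b\<in>Basis. (x \<bullet> b) *\<^sub>R (?f' (z + x) b - ?f' z b))"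
    by (intro vbigo_sum vbigo_bilinear[OF bounded_bilinear_scaleR] vbigo_inner_const
        has_derivative_vbigo[OF Ck_SucD(1)[OF D(2)]])
  ultimately have "vbigo (nhds 0) (\<lambda>x. norm x ^ Suc 1) (\<lambda>x. ?R' x x)"
    by (simp add: power2_eq_square)
  from vbigo_integrate_ray[OF _ der this] linear_0[OF bounded_linear.linear[OF bl]] show ?thesis
    by (simp add: numeral_2_eq_2)
qed

text \<open>On the diagonal \<open>Q\<close> is half of the second derivative; the factor 1/2 is
  part of \<open>Q\<close>.\<close>

definition jet2 :: "('a::real_normed_vector \<Rightarrow> 'b::real_normed_vector) \<Rightarrow> 'a \<Rightarrow> ('a \<Rightarrow> 'b) \<Rightarrow> ('a \<Rightarrow> 'a \<Rightarrow> 'b) \<Rightarrow> bool" where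
  "jet2 f z L Q \<longleftrightarrow> bounded_linear L \<and> bounded_bilinear Q \<and>
     vbigo (nhds 0) (\<lambda>x. norm x ^ 3) (\<lambda>x. f (z + x) - f z - L x - Q x x)"

lemma Ck_jet2:
  fixes f :: "'a::euclidean_space \<Rightarrow> 'b::euclidean_space"
  assumes "Ck 3 f"
  obtains L Q where "jet2 f z L Q"
proof -
  let ?f' = "\<lambda>x. frechet_derivative f (at x)"
  have C: "Ck (Suc 2) f" using assms by (simp only: numeral_3_eq_3 numeral_2_eq_2)
  note D = Ck_SucD[OF C]
  define M where "M = (\<lambda>b. frechet_derivative (\<lambda>x. ?f' x b) (at z))"
  have T: "vbigo (nhds 0) (\<lambda>x. norm x ^ 2) (\<lambda>x. ?f' (z + x) b - ?f' z b - M b x)" for b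
    unfolding M_def by (rule Ck_taylor1[OF D(2)])
  have M: "bounded_linear (M b)" for b
    using Ck_SucD(1)[OF D(2)[unfolded numeral_2_eq_2]] has_derivative_bounded_linear
    unfolding M_def by blast
  \<comment> \<open>The derivative of \<open>Q x x\<close> in direction \<open>x\<close> is twice
    \<open>Q x x\<close>. With the factor 1/2 it equals the sum of \<open>M b x\<close> weighted by
    the coordinates of \<open>x\<close>, which is the linear part of the increment of the derivative
    of \<open>f\<close>.\<close>
  define Q where "Q = (\<lambda>x y. (1/2) *\<^sub>R (\<Sum>b\<in>Basis. (x \<bullet> b) *\<^sub>R M b y))"
  have Q: "bounded_bilinear Q"
    unfolding bilinear_conv_bounded_bilinear[symmetric] bilinear_def
  proof (intro conjI allI)
    fix x
    show "linear (Q x)" unfolding Q_def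
      by (intro linear_compose_scale_right linear_compose_sum bounded_linear.linear[OF M] ballI)
    show "linear (\<lambda>y. Q y x)" unfolding Q_def
      by (intro linear_compose_scale_right linear_compose_sum ballI)
        (simp add: linearI inner_add_left scaleR_add_left)
  qed
  have bl: "bounded_linear (?f' z)" using D(1) has_derivative_bounded_linear by blast
  let ?R = "\<lambda>x. f (z + x) - f z - ?f' z x - Q x x"
    and ?R' = "\<lambda>x v. ?f' (z + x) v - ?f' z v - (Q x v + Q v x)"
  have der: "(?R has_derivative ?R' x) (at x)" for x
  proof -
    have "((\<lambda>x. f (z + x)) has_derivative (\<lambda>v. ?f' (z + x) v)) (at x)"
      by (rule has_derivative_compose[where f = "\<lambda>x. z + x" and g = f, OF _ D(1)])
        (auto intro!: derivative_eq_intros)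
    from has_derivative_diff[OF has_derivative_diff[OF has_derivative_diff[OF this has_derivative_const]
        bounded_linear_imp_has_derivative[OF bl]] bounded_bilinear.FDERIV[OF Q has_derivative_ident has_derivative_ident]]
    show ?thesis by simp
  qed
  \<comment> \<open>Each bracket is the first-order Taylor remainder of a partial derivative, hence
    O(|x|^2); the coordinate in front contributes the third power.\<close>
  have "?R' x x = (\<Sum>b\<in>Basis. (x \<bullet> b) *\<^sub>R (?f' (z + x) b - ?f' z b - M b x))" for x
    using has_derivative_sum_Basis[OF D(1), of z x] has_derivative_sum_Basis[OF D(1), of "z + x" x]
    by (simp add: Q_def scaleR_diff_right sum_subtractf flip: scaleR_left_distrib)
  moreover have "vbigo (nhds 0) (\<lambda>x. norm x * norm x ^ 2)
      (\<lambda>x. \<Sum>b\<in>Basis. (x \<bullet> b) *\<^sub>R (?f' (z + x) b - ?f' z b - M b x))"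
    by (intro vbigo_sum vbigo_bilinear[OF bounded_bilinear_scaleR] vbigo_inner_const T)
  ultimately have "vbigo (nhds 0) (\<lambda>x. norm x ^ Suc 2) (\<lambda>x. ?R' x x)"
    by (simp only: power_Suc)
  from vbigo_integrate_ray[OF _ der this] linear_0[OF bounded_linear.linear[OF bl]]
    bounded_bilinear.zero_left[OF Q] have "vbigo (nhds 0) (\<lambda>x. norm x ^ 3) ?R"
    by (simp add: numeral_3_eq_3 numeral_2_eq_2)
  then show ?thesis using that bl Q unfolding jet2_def by blast
qed

section \<open>Order conditions for additive Runge-Kutta methods\<close>

abbreviation bigh :: "nat \<Rightarrow> (real \<Rightarrow> 'a::real_normed_vector) \<Rightarrow> bool" where
  "bigh n r \<equiv> vbigo (at_right 0) (\<lambda>h. h ^ n) r"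

lemma eventually_at_right_unit: "eventually (\<lambda>h::real. 0 < h \<and> h < 1) (at_right 0)"
  using eventually_at_right_real[of 0 1] by simp

lemma bigh_iff: "bigh n r \<longleftrightarrow> (\<exists>C>0. eventually (\<lambda>h. norm (r h) \<le> C * h ^ n) (at_right 0))"
proof
  assume "bigh n r"
  then obtain C where C: "C > 0" "eventually (\<lambda>h. norm (r h) \<le> C * \<bar>h ^ n\<bar>) (at_right 0)"
    unfolding vbigo_def bigo_def by auto
  from C(2) eventually_at_right_unit have "eventually (\<lambda>h. norm (r h) \<le> C * h ^ n) (at_right 0)"
    by eventually_elim auto
  with C(1) show "\<exists>C>0. eventually (\<lambda>h. norm (r h) \<le> C * h ^ n) (at_right 0)" by blast
next
  assume "\<exists>C>0. eventually (\<lambda>h. norm (r h) \<le> C * h ^ n) (at_right 0)"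
  then obtain C where C: "C > 0" "eventually (\<lambda>h. norm (r h) \<le> C * h ^ n) (at_right 0)" by blast
  from C(2) eventually_at_right_unit have "eventually (\<lambda>h. norm (norm (r h)) \<le> C * norm (h ^ n)) (at_right 0)"
    by eventually_elim auto
  then show "bigh n r" unfolding vbigo_def by (rule bigoI)
qed

lemma bigh_mono:
  assumes "bigh n r" "m \<le> n"
  shows "bigh m r"
proof -
  have "eventually (\<lambda>h. norm (h ^ n) \<le> 1 * norm (h ^ m :: real)) (at_right 0)"
    using eventually_at_right_unit by eventually_elim (use assms(2) in \<open>auto intro: power_decreasing\<close>)
  from bigoI[OF this] show ?thesis by (rule vbigo_mono[OF assms(1)])
qed

lemma bigh_scaleR: "bigh n r \<Longrightarrow> bigh (k + n) (\<lambda>h. h ^ k *\<^sub>R r h)"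
  using vbigo_bilinear[OF bounded_bilinear_scaleR, of "at_right 0" "\<lambda>h. h ^ k" "\<lambda>h. h ^ k" "\<lambda>h. h ^ n" r]
  by (simp add: vbigo_def power_add)

lemma bigh_step: "bigh n r \<Longrightarrow> m = Suc n \<Longrightarrow> bigh m (\<lambda>h. h *\<^sub>R r h)"
  using bigh_scaleR[of n r 1] by simp

lemma bigh_const: "bigh 0 (\<lambda>h. c)"
  unfolding bigh_iff by (rule exI[of _ "norm c + 1"]) (auto intro: add_nonneg_pos)

lemma bigh_monomial: "bigh n (\<lambda>h. h ^ n *\<^sub>R c)"
  using bigh_scaleR[OF bigh_const, of n c] by simp

lemma bigh_bilinear:
  assumes "bounded_bilinear B" "bigh m r" "bigh n r'"
  shows "bigh (m + n) (\<lambda>h. B (r h) (r' h))"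
  using vbigo_bilinear[OF assms] by (simp add: power_add)

lemma power_bound_tendsto_0:
  assumes "eventually (\<lambda>h. norm (r h) \<le> C * h ^ Suc n) (at_right 0)"
  shows "(r \<longlongrightarrow> 0) (at_right 0)"
proof -
  have "((\<lambda>h::real. C * h ^ Suc n) \<longlongrightarrow> C * 0 ^ Suc n) (at_right 0)"
    by (intro tendsto_intros)
  then show ?thesis using assms by (auto intro: Lim_null_comparison)
qed

lemma bigh_Suc_tendsto: "bigh (Suc n) r \<Longrightarrow> (r \<longlongrightarrow> 0) (at_right 0)"
  unfolding bigh_iff by (blast intro: power_bound_tendsto_0)

lemma tendsto_bigh_0:
  assumes "(X \<longlongrightarrow> l) (at_right 0)"
  shows "bigh 0 X"
proof -
  have "eventually (\<lambda>h. dist (X h) l < 1) (at_right 0)" using assms by (rule tendstoD) simp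
  then have "eventually (\<lambda>h. norm (X h) \<le> (norm l + 1) * h ^ 0) (at_right 0)"
  proof eventually_elim
    case (elim h)
    have "norm (X h) \<le> norm l + norm (X h - l)" using norm_triangle_sub by blast
    with elim show ?case by (simp add: dist_norm)
  qed
  moreover have "norm l + 1 > 0" by (simp add: add_nonneg_pos)
  ultimately show ?thesis unfolding bigh_iff by blast
qed

text \<open>Integration from 0 gains a power of h. The mean value inequality takes the place of the
  integral: |r(h)| is at most h |r'(t)| for some t between 0 and h, and t^n is at most h^n.\<close>

lemma bigh_integral:
  fixes r :: "real \<Rightarrow> 'a::real_inner"
  assumes "e > 0" "\<And>t. t \<in> ball 0 e \<Longrightarrow> (r has_vector_derivative r' t) (at t)"
    and "r 0 = 0" "bigh n r'"
  shows "bigh (Suc n) r"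
proof -
  obtain C where C: "C > 0" "eventually (\<lambda>h. norm (r' h) \<le> C * h ^ n) (at_right 0)"
    using assms(4) unfolding bigh_iff by blast
  then obtain d where d: "d > 0" "\<And>h. 0 < h \<Longrightarrow> h < d \<Longrightarrow> norm (r' h) \<le> C * h ^ n"
    unfolding eventually_at_right_field by auto
  have "norm (r h) \<le> C * h ^ Suc n" if h: "0 < h" "h < min d e" for h
  proof -
    have cont: "continuous_on {0..h} r"
      using h by (intro continuous_at_imp_continuous_on ballI has_vector_derivative_continuous[OF assms(2)])
        (auto simp: dist_real_def)
    have der: "(r has_derivative (\<lambda>u. u *\<^sub>R r' t)) (at t)" if "0 < t" "t < h" for t
      using assms(2)[of t] that h by (auto simp: has_vector_derivative_def dist_real_def)
    from mvt_general[OF h(1) cont der]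
    obtain t where t: "0 < t" "t < h" "norm (r h - r 0) \<le> norm ((h - 0) *\<^sub>R r' t)"
      by auto
    then have "norm (r h) \<le> h * norm (r' t)" using h assms(3) by simp
    also have "\<dots> \<le> h * (C * t ^ n)" using d(2)[of t] t h by (intro mult_left_mono) auto
    also have "\<dots> \<le> h * (C * h ^ n)" using t h C(1) by (intro mult_left_mono power_mono) auto
    finally show ?thesis by (simp add: mult_ac)
  qed
  then have "eventually (\<lambda>h. norm (r h) \<le> C * h ^ Suc n) (at_right 0)"
    unfolding eventually_at_right_field using d(1) assms(1) by (intro exI[of _ "min d e"]) auto
  with C(1) show ?thesis unfolding bigh_iff by blast
qed

section \<open>Taylor polynomials along curves with a known expansion\<close>

lemma jet2_curve:
  assumes "jet2 f z L Q" "bigh 1 (\<lambda>h. X h - z)"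
  shows "bigh 3 (\<lambda>h. f (X h) - f z - L (X h - z) - Q (X h - z) (X h - z))"
proof -
  have "((\<lambda>h. X h - z) \<longlongrightarrow> 0) (at_right 0)"
    using assms(2) bigh_Suc_tendsto[of 0] by simp
  from vbigo_compose[OF _ this, of 3 "\<lambda>x. f (z + x) - f z - L x - Q x x" "\<lambda>h. h"] assms
  show ?thesis unfolding jet2_def by simp
qed

lemma jet2_curve1:
  assumes "jet2 f z L Q" "bigh 1 (\<lambda>h. X h - z)"
  shows "bigh 1 (\<lambda>h. f (X h) - f z)"
proof -
  have L: "bounded_linear L" and Q: "bounded_bilinear Q" using assms(1) by (auto simp: jet2_def)
  have "bigh 1 (\<lambda>h. (f (X h) - f z - L (X h - z) - Q (X h - z) (X h - z)) + L (X h - z) + Q (X h - z) (X h - z))"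
    by (intro vbigo_add vbigo_linear[OF L] bigh_mono[OF jet2_curve[OF assms]] assms(2)
        bigh_mono[OF bigh_bilinear[OF Q assms(2) assms(2)]]) auto
  then show ?thesis by simp
qed

lemma jet2_curve2:
  assumes "jet2 f z L Q" and X: "bigh 2 (\<lambda>h. X h - z - h *\<^sub>R v)"
  shows "bigh 2 (\<lambda>h. f (X h) - f z - h *\<^sub>R L v)"
proof -
  have L: "bounded_linear L" and Q: "bounded_bilinear Q" using assms(1) by (auto simp: jet2_def)
  have "bigh 1 (\<lambda>h. (X h - z - h *\<^sub>R v) + h ^ 1 *\<^sub>R v)"
    by (intro vbigo_add bigh_mono[OF X] bigh_monomial) simp
  then have X1: "bigh 1 (\<lambda>h. X h - z)" by simp
  have "bigh 2 (\<lambda>h. (f (X h) - f z - L (X h - z) - Q (X h - z) (X h - z)) + L (X h - z - h *\<^sub>R v) + Q (X h - z) (X h - z))"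
    by (intro vbigo_add vbigo_linear[OF L] bigh_mono[OF jet2_curve[OF assms(1) X1]] X
        bigh_mono[OF bigh_bilinear[OF Q X1 X1]]) auto
  then show ?thesis by (simp add: linear_diff[OF bounded_linear.linear[OF L]] linear_cmul[OF bounded_linear.linear[OF L]])
qed

lemma jet2_curve3:
  assumes "jet2 f z L Q" and X: "bigh 3 (\<lambda>h. X h - z - h *\<^sub>R v - h ^ 2 *\<^sub>R u)"
  shows "bigh 3 (\<lambda>h. f (X h) - f z - h *\<^sub>R L v - h ^ 2 *\<^sub>R (L u + Q v v))"
proof -
  have L: "bounded_linear L" and Q: "bounded_bilinear Q" using assms(1) by (auto simp: jet2_def)
  have "bigh 2 (\<lambda>h. (X h - z - h *\<^sub>R v - h ^ 2 *\<^sub>R u) + h ^ 2 *\<^sub>R u)"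
    by (intro vbigo_add bigh_mono[OF X] bigh_monomial) simp
  then have X2: "bigh 2 (\<lambda>h. X h - z - h *\<^sub>R v)" by simp
  have V1: "bigh 1 (\<lambda>h. h *\<^sub>R v)" using bigh_monomial[of 1 v] by simp
  have "bigh 1 (\<lambda>h. (X h - z - h *\<^sub>R v) + h *\<^sub>R v)"
    by (intro vbigo_add bigh_mono[OF X2] V1) simp
  then have X1: "bigh 1 (\<lambda>h. X h - z)" by simp
  \<comment> \<open>With x = X h - z, the difference Q x x - h^2 Q v v splits into Q x (x - h v) + Q
    (x - h v) (h v). Each summand pairs a factor O(h) with a factor O(h^2).\<close>
  have "bigh 3 (\<lambda>h. (f (X h) - f z - L (X h - z) - Q (X h - z) (X h - z))
      + L (X h - z - h *\<^sub>R v - h ^ 2 *\<^sub>R u)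
      + Q (X h - z) (X h - z - h *\<^sub>R v) + Q (X h - z - h *\<^sub>R v) (h *\<^sub>R v))"
    by (intro vbigo_add vbigo_linear[OF L] jet2_curve[OF assms(1) X1] X
        bigh_mono[OF bigh_bilinear[OF Q X1 X2]] bigh_mono[OF bigh_bilinear[OF Q X2 V1]]) auto
  moreover have "(E - L x - Q x x) + L (x - h *\<^sub>R v - h ^ 2 *\<^sub>R u) + Q x (x - h *\<^sub>R v) + Q (x - h *\<^sub>R v) (h *\<^sub>R v)
      = E - h *\<^sub>R L v - h ^ 2 *\<^sub>R (L u + Q v v)" for E x h
    by (simp add: linear_diff[OF bounded_linear.linear[OF L]] linear_add[OF bounded_linear.linear[OF L]]
        linear_cmul[OF bounded_linear.linear[OF L]] bounded_bilinear.diff_left[OF Q]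
        bounded_bilinear.diff_right[OF Q] bounded_bilinear.scaleR_left[OF Q]
        bounded_bilinear.scaleR_right[OF Q] power2_eq_square scaleR_right_distrib algebra_simps)
  ultimately show ?thesis by (simp only:)
qed

section \<open>Order conditions and the expansions of the exact and the numerical solution\<close>

definition row_sum :: "nat \<Rightarrow> (nat \<Rightarrow> nat \<Rightarrow> real) \<Rightarrow> nat \<Rightarrow> real" where
  "row_sum s M i = (\<Sum>j=1..s. M i j)"

text \<open>These are the conditions for the coloured rooted trees with at most three vertices. The
  indices \<open>\<mu>\<close>, \<open>\<nu>\<close> colour the vertices other than the root; the
  colour of the root is invisible because all parts share the weights \<open>w\<close>.\<close>

definition order3_conditions :: "nat \<Rightarrow> ('n \<Rightarrow> nat \<Rightarrow> nat \<Rightarrow> real) \<Rightarrow> (nat \<Rightarrow> real) \<Rightarrow> bool" where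
  "order3_conditions s A w \<longleftrightarrow>
     (\<Sum>i=1..s. w i) = 1 \<and>
     (\<forall>\<mu>. (\<Sum>i=1..s. w i * row_sum s (A \<mu>) i) = 1 / 2) \<and>
     (\<forall>\<mu> \<nu>. (\<Sum>i=1..s. w i * (row_sum s (A \<mu>) i * row_sum s (A \<nu>) i)) = 1 / 3) \<and>
     (\<forall>\<mu> \<nu>. (\<Sum>i=1..s. w i * (\<Sum>j=1..s. A \<mu> i j * row_sum s (A \<nu>) j)) = 1 / 6)"

text \<open>A bootstrap: continuity bounds the derivative, and every expansion of z inserted into
  the fields and integrated yields one more power of h. The last coefficient is z'''/6, where z'''
  consists of the sum of \<open>L \<nu> LG\<close> and twice the sum of \<open>Q \<nu> G G\<close>,
  since \<open>Q \<nu>\<close> is half of a second derivative.\<close>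

lemma ark_solution_expansion:
  fixes F :: "'n::finite \<Rightarrow> 'a::euclidean_space \<Rightarrow> 'a"
  assumes jet: "\<And>\<nu>. jet2 (F \<nu>) (z t0) (L \<nu>) (Q \<nu>)" and cont: "\<And>\<nu>. isCont (F \<nu>) (z t0)"
    and "e > 0" and der: "\<And>t. t \<in> ball t0 e \<Longrightarrow> (z has_vector_derivative (\<Sum>\<nu>\<in>UNIV. F \<nu> (z t))) (at t)"
  defines "G \<equiv> \<Sum>\<nu>\<in>UNIV. F \<nu> (z t0)"
  defines "LG \<equiv> \<Sum>\<nu>\<in>UNIV. L \<nu> G"
  shows "bigh 4 (\<lambda>h. z (t0 + h) - z t0 - h *\<^sub>R G - h ^ 2 *\<^sub>R ((1/2) *\<^sub>R LG)
      - h ^ 3 *\<^sub>R ((1/6) *\<^sub>R (\<Sum>\<nu>\<in>UNIV. L \<nu> LG) + (1/3) *\<^sub>R (\<Sum>\<nu>\<in>UNIV. Q \<nu> G G)))"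
proof -
  let ?X = "\<lambda>h. z (t0 + h)"
  have dX: "(?X has_vector_derivative (\<Sum>\<nu>\<in>UNIV. F \<nu> (?X t))) (at t)" if "t \<in> ball 0 e" for t
  proof -
    have "t0 + t \<in> ball t0 e" using that by (simp add: dist_real_def)
    from vector_diff_chain_at[of "\<lambda>h. t0 + h" 1 t z, OF _ der[OF this]] show ?thesis
      by (simp add: o_def has_vector_derivative_const has_vector_derivative_id
          has_vector_derivative_add[OF has_vector_derivative_const has_vector_derivative_id, simplified])
  qed
  have lin: "linear (L \<nu>)" for \<nu> using jet by (auto simp: jet2_def bounded_linear.linear)
  have Q: "bounded_bilinear (Q \<nu>)" for \<nu> using jet by (auto simp: jet2_def)
  have "(?X \<longlongrightarrow> z (t0 + 0)) (at_right 0)"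
    using has_vector_derivative_continuous[OF dX[of 0]] \<open>e > 0\<close>
    by (auto simp: continuous_at intro: tendsto_within_subset)
  then have t: "((\<lambda>h. \<Sum>\<nu>\<in>UNIV. F \<nu> (?X h)) \<longlongrightarrow> (\<Sum>\<nu>\<in>UNIV. F \<nu> (z t0))) (at_right 0)"
    by (intro tendsto_sum isCont_tendsto_compose[OF cont]) simp
  have "bigh (Suc 0) (\<lambda>h. ?X h - z t0)"
    by (rule bigh_integral[OF \<open>e > 0\<close> _ _ tendsto_bigh_0[OF t]])
      (auto intro!: derivative_eq_intros dX)
  then have X1: "bigh 1 (\<lambda>h. ?X h - z t0)" by simp
  have "bigh 1 (\<lambda>h. \<Sum>\<nu>\<in>UNIV. F \<nu> (?X h) - F \<nu> (z t0))"
    by (intro vbigo_sum jet2_curve1[OF jet X1])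
  then have "bigh (Suc 1) (\<lambda>h. ?X h - z t0 - h *\<^sub>R G)"
    by (rule bigh_integral[OF \<open>e > 0\<close>, rotated 2])
      (auto intro!: derivative_eq_intros dX simp: G_def sum_subtractf)
  then have X2: "bigh 2 (\<lambda>h. ?X h - z t0 - h *\<^sub>R G)" by (simp add: numeral_2_eq_2)
  have "bigh 2 (\<lambda>h. \<Sum>\<nu>\<in>UNIV. F \<nu> (?X h) - F \<nu> (z t0) - h *\<^sub>R L \<nu> G)"
    by (intro vbigo_sum jet2_curve2[OF jet X2])
  then have "bigh (Suc 2) (\<lambda>h. ?X h - z t0 - h *\<^sub>R G - h ^ 2 *\<^sub>R ((1/2) *\<^sub>R LG))"
    by (rule bigh_integral[OF \<open>e > 0\<close>, rotated 2])
      (auto intro!: derivative_eq_intros dX simp: G_def LG_def sum_subtractf scaleR_sum_right)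
  then have X3: "bigh 3 (\<lambda>h. ?X h - z t0 - h *\<^sub>R G - h ^ 2 *\<^sub>R ((1/2) *\<^sub>R LG))"
    by (simp add: numeral_2_eq_2 numeral_3_eq_3)
  have "bigh 3 (\<lambda>h. \<Sum>\<nu>\<in>UNIV. F \<nu> (?X h) - F \<nu> (z t0) - h *\<^sub>R L \<nu> G
      - h ^ 2 *\<^sub>R ((1/2) *\<^sub>R L \<nu> LG + Q \<nu> G G))"
    by (intro vbigo_sum jet2_curve3[OF jet X3, unfolded linear_cmul[OF lin]])
  then have "bigh (Suc 3) (\<lambda>h. ?X h - z t0 - h *\<^sub>R G - h ^ 2 *\<^sub>R ((1/2) *\<^sub>R LG)
      - h ^ 3 *\<^sub>R ((1/6) *\<^sub>R (\<Sum>\<nu>\<in>UNIV. L \<nu> LG) + (1/3) *\<^sub>R (\<Sum>\<nu>\<in>UNIV. Q \<nu> G G)))"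
    by (rule bigh_integral[OF \<open>e > 0\<close>, rotated 2])
      (auto intro!: derivative_eq_intros dX simp: G_def[symmetric] LG_def[symmetric] sum_subtractf sum.distrib
        scaleR_right_distrib simp flip: scaleR_sum_right)
  then show ?thesis by simp
qed

lemma sum_weights_linear:
  fixes v :: "'n \<Rightarrow> 'a::real_vector"
  shows "(\<Sum>i\<in>I. w i *\<^sub>R (\<Sum>\<nu>\<in>N. c \<nu> i *\<^sub>R v \<nu>)) = (\<Sum>\<nu>\<in>N. (\<Sum>i\<in>I. w i * c \<nu> i) *\<^sub>R v \<nu>)"
  by (simp add: scaleR_sum_right scaleR_sum_left sum.swap[of _ N I])

lemma sum_scaleR_swap:
  fixes g :: "'n \<Rightarrow> 'i \<Rightarrow> 'a::real_vector"
  shows "(\<Sum>i\<in>I. w i *\<^sub>R (\<Sum>\<nu>\<in>N. g \<nu> i)) = (\<Sum>\<nu>\<in>N. \<Sum>i\<in>I. w i *\<^sub>R g \<nu> i)"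
  unfolding scaleR_sum_right by (rule sum.swap)

text \<open>The same bootstrap runs through the stage equations, whose factor h gains a power in
  each round even though they are implicit. The order conditions then evaluate the weighted sums of
  the stage coefficients to exactly the coefficients of the exact solution.\<close>

lemma ark_step_expansion:
  fixes F :: "'n::finite \<Rightarrow> 'a::euclidean_space \<Rightarrow> 'a"
  assumes jet: "\<And>\<nu>. jet2 (F \<nu>) z0 (L \<nu>) (Q \<nu>)"
    and cond: "order3_conditions s A w"
    and stages: "eventually (\<lambda>h. \<forall>i\<in>{1..s}. Z h i = z0 + h *\<^sub>R (\<Sum>\<nu>\<in>UNIV. \<Sum>j=1..s. A \<nu> i j *\<^sub>R F \<nu> (Z h j))) (at_right 0)"
    and lim: "\<And>i. i \<in> {1..s} \<Longrightarrow> ((\<lambda>h. Z h i) \<longlongrightarrow> z0) (at_right 0)"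
    and cont: "\<And>\<nu>. isCont (F \<nu>) z0"
  defines "G \<equiv> \<Sum>\<nu>\<in>UNIV. F \<nu> z0"
  defines "LG \<equiv> \<Sum>\<nu>\<in>UNIV. L \<nu> G"
  shows "bigh 4 (\<lambda>h. h *\<^sub>R (\<Sum>\<nu>\<in>UNIV. \<Sum>j=1..s. w j *\<^sub>R F \<nu> (Z h j)) - h *\<^sub>R G - h ^ 2 *\<^sub>R ((1/2) *\<^sub>R LG)
      - h ^ 3 *\<^sub>R ((1/6) *\<^sub>R (\<Sum>\<nu>\<in>UNIV. L \<nu> LG) + (1/3) *\<^sub>R (\<Sum>\<nu>\<in>UNIV. Q \<nu> G G)))"
proof -
  have L: "bounded_linear (L \<nu>)" and Q: "bounded_bilinear (Q \<nu>)" for \<nu> using jet by (auto simp: jet2_def)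
  note lin = bounded_linear.linear[OF L]
  let ?K = "\<lambda>\<nu> j h. F \<nu> (Z h j)"
  \<comment> \<open>\<open>v i\<close> and \<open>u i\<close> will be the coefficients of h and h^2
    in stage \<open>i\<close>.\<close>
  define v where "v i = (\<Sum>\<nu>\<in>UNIV. \<Sum>j=1..s. A \<nu> i j *\<^sub>R F \<nu> z0)" for i
  define u where "u i = (\<Sum>\<nu>\<in>UNIV. \<Sum>j=1..s. A \<nu> i j *\<^sub>R L \<nu> (v j))" for i
  have bl: "bounded_linear (\<lambda>x. c *\<^sub>R x)" for c :: real by (rule bounded_linear_scaleR_right)
  have ev: "eventually (\<lambda>h. Z h i = z0 + h *\<^sub>R (\<Sum>\<nu>\<in>UNIV. \<Sum>j=1..s. A \<nu> i j *\<^sub>R ?K \<nu> j h)) (at_right 0)"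
    if "i \<in> {1..s}" for i
    using stages by eventually_elim (use that in auto)
  have Z1: "bigh 1 (\<lambda>h. Z h i - z0)" if i: "i \<in> {1..s}" for i
  proof (rule vbigo_cong_ev)
    \<comment> \<open>The assumed convergence of the stages bounds the field values, which starts
      the bootstrap.\<close>
    have "bigh 0 (\<lambda>h. \<Sum>\<nu>\<in>UNIV. \<Sum>j=1..s. A \<nu> i j *\<^sub>R ?K \<nu> j h)"
      by (intro vbigo_sum vbigo_linear[OF bl] tendsto_bigh_0[OF isCont_tendsto_compose[OF cont lim]])
    then show "bigh 1 (\<lambda>h. h *\<^sub>R (\<Sum>\<nu>\<in>UNIV. \<Sum>j=1..s. A \<nu> i j *\<^sub>R ?K \<nu> j h))"
      by (rule bigh_step) simp
    show "eventually (\<lambda>h. h *\<^sub>R (\<Sum>\<nu>\<in>UNIV. \<Sum>j=1..s. A \<nu> i j *\<^sub>R ?K \<nu> j h) = Z h i - z0) (at_right 0)"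
      using ev[OF i]
    proof eventually_elim
      case (elim h)
      show ?case by (subst elim) simp
    qed
  qed
  have Z2: "bigh 2 (\<lambda>h. Z h i - z0 - h *\<^sub>R v i)" if i: "i \<in> {1..s}" for i
  proof (rule vbigo_cong_ev)
    have "bigh 1 (\<lambda>h. \<Sum>\<nu>\<in>UNIV. \<Sum>j=1..s. A \<nu> i j *\<^sub>R (?K \<nu> j h - F \<nu> z0))"
      by (intro vbigo_sum vbigo_linear[OF bl] jet2_curve1[OF jet Z1])
    then show "bigh 2 (\<lambda>h. h *\<^sub>R (\<Sum>\<nu>\<in>UNIV. \<Sum>j=1..s. A \<nu> i j *\<^sub>R (?K \<nu> j h - F \<nu> z0)))"
      by (rule bigh_step) simp
    show "eventually (\<lambda>h. h *\<^sub>R (\<Sum>\<nu>\<in>UNIV. \<Sum>j=1..s. A \<nu> i j *\<^sub>R (?K \<nu> j h - F \<nu> z0)) = Z h i - z0 - h *\<^sub>R v i) (at_right 0)"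
      using ev[OF i]
    proof eventually_elim
      case (elim h)
      have "Z h i - z0 = h *\<^sub>R (\<Sum>\<nu>\<in>UNIV. \<Sum>j=1..s. A \<nu> i j *\<^sub>R ?K \<nu> j h)"
        by (subst elim) simp
      then show ?case by (simp add: v_def scaleR_diff_right sum_subtractf)
    qed
  qed
  have Z3: "bigh 3 (\<lambda>h. Z h i - z0 - h *\<^sub>R v i - h ^ 2 *\<^sub>R u i)" if i: "i \<in> {1..s}" for i
  proof (rule vbigo_cong_ev)
    have "bigh 2 (\<lambda>h. \<Sum>\<nu>\<in>UNIV. \<Sum>j=1..s. A \<nu> i j *\<^sub>R (?K \<nu> j h - F \<nu> z0 - h *\<^sub>R L \<nu> (v j)))"
      by (intro vbigo_sum vbigo_linear[OF bl] jet2_curve2[OF jet Z2])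
    then show "bigh 3 (\<lambda>h. h *\<^sub>R (\<Sum>\<nu>\<in>UNIV. \<Sum>j=1..s. A \<nu> i j *\<^sub>R (?K \<nu> j h - F \<nu> z0 - h *\<^sub>R L \<nu> (v j))))"
      by (rule bigh_step) simp
    show "eventually (\<lambda>h. h *\<^sub>R (\<Sum>\<nu>\<in>UNIV. \<Sum>j=1..s. A \<nu> i j *\<^sub>R (?K \<nu> j h - F \<nu> z0 - h *\<^sub>R L \<nu> (v j)))
        = Z h i - z0 - h *\<^sub>R v i - h ^ 2 *\<^sub>R u i) (at_right 0)"
      using ev[OF i]
    proof eventually_elim
      case (elim h)
      have "Z h i - z0 = h *\<^sub>R (\<Sum>\<nu>\<in>UNIV. \<Sum>j=1..s. A \<nu> i j *\<^sub>R ?K \<nu> j h)"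
        by (subst elim) simp
      then show ?case
        by (simp add: v_def u_def scaleR_diff_right sum_subtractf scaleR_sum_right power2_eq_square mult_ac)
    qed
  qed
  have "bigh 3 (\<lambda>h. \<Sum>\<nu>\<in>UNIV. \<Sum>j=1..s. w j *\<^sub>R (?K \<nu> j h - F \<nu> z0 - h *\<^sub>R L \<nu> (v j)
      - h ^ 2 *\<^sub>R (L \<nu> (u j) + Q \<nu> (v j) (v j))))"
    by (intro vbigo_sum vbigo_linear[OF bl] jet2_curve3[OF jet Z3])
  then have E: "bigh 4 (\<lambda>h. h *\<^sub>R (\<Sum>\<nu>\<in>UNIV. \<Sum>j=1..s. w j *\<^sub>R (?K \<nu> j h - F \<nu> z0 - h *\<^sub>R L \<nu> (v j)
      - h ^ 2 *\<^sub>R (L \<nu> (u j) + Q \<nu> (v j) (v j)))))"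
    by (rule bigh_step) simp
  define c where "c \<mu> = row_sum s (A \<mu>)" for \<mu>
  have v: "v i = (\<Sum>\<mu>\<in>UNIV. c \<mu> i *\<^sub>R F \<mu> z0)" for i
    by (simp add: v_def c_def row_sum_def scaleR_sum_left)
  have C0: "(\<Sum>i=1..s. w i) = 1" and C1: "(\<Sum>i=1..s. w i * c \<mu> i) = 1 / 2"
    and C2: "(\<Sum>i=1..s. w i * (c \<mu> i * c \<nu> i)) = 1 / 3"
    and C3: "(\<Sum>i=1..s. w i * (\<Sum>j=1..s. A \<mu> i j * c \<nu> j)) = 1 / 6" for \<mu> \<nu>
    using cond by (auto simp: order3_conditions_def c_def)
  have T0: "(\<Sum>j=1..s. w j *\<^sub>R x) = x" for x :: 'a
    unfolding scaleR_sum_left[symmetric] C0 by simp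
  have wv: "(\<Sum>j=1..s. w j *\<^sub>R v j) = (1/2) *\<^sub>R G"
    unfolding v sum_weights_linear C1 G_def by (simp add: scaleR_sum_right)
  have T1: "(\<Sum>j=1..s. w j *\<^sub>R L \<nu> (v j)) = (1/2) *\<^sub>R L \<nu> G" for \<nu>
    using wv[THEN arg_cong[of _ _ "L \<nu>"]] by (simp add: linear_sum[OF lin] linear_cmul[OF lin])
  \<comment> \<open>By linearity \<open>L \<nu> (v j)\<close> combines the vectors
    \<open>L \<nu> (F \<mu> z0)\<close> with the row sums as coefficients. After exchanging the sums
    every coefficient is the chain-tree sum \<open>C3\<close>, equal to 1/6.\<close>
  have wu: "(\<Sum>j=1..s. w j *\<^sub>R u j) = (1/6) *\<^sub>R LG"
  proof -
    have inner: "(\<Sum>j=1..s. A \<nu> i j *\<^sub>R L \<nu> (v j)) = (\<Sum>\<mu>\<in>UNIV. (\<Sum>j=1..s. A \<nu> i j * c \<mu> j) *\<^sub>R L \<nu> (F \<mu> z0))" for i \<nu>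
      unfolding v linear_sum[OF lin] linear_cmul[OF lin] sum_weights_linear ..
    have "(\<Sum>j=1..s. w j *\<^sub>R u j) = (\<Sum>\<nu>\<in>UNIV. \<Sum>i=1..s. w i *\<^sub>R (\<Sum>\<mu>\<in>UNIV. (\<Sum>j=1..s. A \<nu> i j * c \<mu> j) *\<^sub>R L \<nu> (F \<mu> z0)))"
      unfolding u_def sum_scaleR_swap inner ..
    also have "\<dots> = (\<Sum>\<nu>\<in>UNIV. \<Sum>\<mu>\<in>UNIV. (1/6) *\<^sub>R L \<nu> (F \<mu> z0))"
      unfolding sum_weights_linear C3 ..
    also have "\<dots> = (1/6) *\<^sub>R LG"
      by (simp add: LG_def G_def linear_sum[OF lin] scaleR_sum_right)
    finally show ?thesis .
  qed
  have T2: "(\<Sum>j=1..s. w j *\<^sub>R L \<nu> (u j)) = (1/6) *\<^sub>R L \<nu> LG" for \<nu>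
    using wu[THEN arg_cong[of _ _ "L \<nu>"]] by (simp add: linear_sum[OF lin] linear_cmul[OF lin])
  have T3: "(\<Sum>j=1..s. w j *\<^sub>R Q \<nu> (v j) (v j)) = (1/3) *\<^sub>R Q \<nu> G G" for \<nu>
  proof -
    \<comment> \<open>Expanding both arguments of \<open>Q \<nu>\<close> produces the mixed products
      \<open>c \<mu> j * c \<kappa> j\<close>; this is where \<open>C2\<close> is used for two
      different parts.\<close>
    have exp: "Q \<nu> (\<Sum>\<mu>\<in>UNIV. x \<mu>) (\<Sum>\<mu>\<in>UNIV. y \<mu>) = (\<Sum>\<mu>\<in>UNIV. \<Sum>\<kappa>\<in>UNIV. Q \<nu> (x \<mu>) (y \<kappa>))" for x y :: "'n \<Rightarrow> 'a"
      by (subst bounded_bilinear.sum_left[OF Q]) (simp only: bounded_bilinear.sum_right[OF Q])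
    have inner: "Q \<nu> (v j) (v j) = (\<Sum>\<mu>\<in>UNIV. \<Sum>\<kappa>\<in>UNIV. (c \<mu> j * c \<kappa> j) *\<^sub>R Q \<nu> (F \<mu> z0) (F \<kappa> z0))" for j
      unfolding v exp by (simp add: bounded_bilinear.scaleR_left[OF Q] bounded_bilinear.scaleR_right[OF Q] mult_ac)
    have "(\<Sum>j=1..s. w j *\<^sub>R Q \<nu> (v j) (v j))
        = (\<Sum>\<mu>\<in>UNIV. \<Sum>j=1..s. w j *\<^sub>R (\<Sum>\<kappa>\<in>UNIV. (c \<mu> j * c \<kappa> j) *\<^sub>R Q \<nu> (F \<mu> z0) (F \<kappa> z0)))"
      unfolding inner by (rule sum_scaleR_swap)
    also have "\<dots> = (\<Sum>\<mu>\<in>UNIV. \<Sum>\<kappa>\<in>UNIV. (1/3) *\<^sub>R Q \<nu> (F \<mu> z0) (F \<kappa> z0))"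
      unfolding sum_weights_linear C2 ..
    also have "\<dots> = (1/3) *\<^sub>R Q \<nu> G G"
      unfolding G_def exp by (simp add: scaleR_sum_right)
    finally show ?thesis .
  qed
  have "h *\<^sub>R (\<Sum>\<nu>\<in>UNIV. \<Sum>j=1..s. w j *\<^sub>R (?K \<nu> j h - F \<nu> z0 - h *\<^sub>R L \<nu> (v j)
      - h ^ 2 *\<^sub>R (L \<nu> (u j) + Q \<nu> (v j) (v j))))
    = h *\<^sub>R (\<Sum>\<nu>\<in>UNIV. \<Sum>j=1..s. w j *\<^sub>R F \<nu> (Z h j)) - h *\<^sub>R G - h ^ 2 *\<^sub>R ((1/2) *\<^sub>R LG)
      - h ^ 3 *\<^sub>R ((1/6) *\<^sub>R (\<Sum>\<nu>\<in>UNIV. L \<nu> LG) + (1/3) *\<^sub>R (\<Sum>\<nu>\<in>UNIV. Q \<nu> G G))" for h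
  proof -
    have inner: "(\<Sum>j=1..s. w j *\<^sub>R (?K \<nu> j h - F \<nu> z0 - h *\<^sub>R L \<nu> (v j) - h ^ 2 *\<^sub>R (L \<nu> (u j) + Q \<nu> (v j) (v j))))
      = (\<Sum>j=1..s. w j *\<^sub>R ?K \<nu> j h) - (\<Sum>j=1..s. w j *\<^sub>R F \<nu> z0) - h *\<^sub>R (\<Sum>j=1..s. w j *\<^sub>R L \<nu> (v j))
        - h ^ 2 *\<^sub>R ((\<Sum>j=1..s. w j *\<^sub>R L \<nu> (u j)) + (\<Sum>j=1..s. w j *\<^sub>R Q \<nu> (v j) (v j)))" for \<nu>
      by (simp add: scaleR_diff_right scaleR_right_distrib sum_subtractf sum.distrib scaleR_sum_right mult_ac)
    show ?thesis
      unfolding inner T0 T1 T2 T3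
      by (simp add: G_def[symmetric] LG_def[symmetric] scaleR_diff_right scaleR_right_distrib sum_subtractf
          sum.distrib power2_eq_square power3_eq_cube mult_ac flip: scaleR_sum_right)
  qed
  with E show ?thesis by simp
qed

lemma ark_order3:
  fixes F :: "'n::finite \<Rightarrow> 'a::euclidean_space \<Rightarrow> 'a"
  assumes Ck: "\<And>\<nu>. Ck 3 (F \<nu>)"
    and cond: "order3_conditions s A w"
    and stages: "eventually (\<lambda>h. \<forall>i\<in>{1..s}. Z h i = z t0 + h *\<^sub>R (\<Sum>\<nu>\<in>UNIV. \<Sum>j=1..s. A \<nu> i j *\<^sub>R F \<nu> (Z h j))) (at_right 0)"
    and lim: "\<And>i. i \<in> {1..s} \<Longrightarrow> ((\<lambda>h. Z h i) \<longlongrightarrow> z t0) (at_right 0)"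
    and e: "e > 0" and der: "\<And>t. t \<in> ball t0 e \<Longrightarrow> (z has_vector_derivative (\<Sum>\<nu>\<in>UNIV. F \<nu> (z t))) (at t)"
  shows "bigh 4 (\<lambda>h. z t0 + h *\<^sub>R (\<Sum>\<nu>\<in>UNIV. \<Sum>j=1..s. w j *\<^sub>R F \<nu> (Z h j)) - z (t0 + h))"
proof -
  have "\<exists>L Q. jet2 (F \<nu>) (z t0) L Q" for \<nu> using Ck_jet2[OF Ck] by metis
  then obtain L Q where jet: "\<And>\<nu>. jet2 (F \<nu>) (z t0) (L \<nu>) (Q \<nu>)" by metis
  have cont: "isCont (F \<nu>) x" for \<nu> x
    using Ck_SucD(1)[of 2 "F \<nu>" x] Ck[of \<nu>] has_derivative_continuous
    by (auto simp: numeral_3_eq_3 numeral_2_eq_2)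
  \<comment> \<open>Both expansions have the same terms through h^3, so these cancel in the
    difference.\<close>
  show ?thesis
    using vbigo_diff[OF ark_step_expansion[OF jet cond stages lim cont] ark_solution_expansion[OF jet cont e der]]
    by (simp add: algebra_simps)
qed

section \<open>Adjoint coefficients\<close>

text \<open>\<open>Inl\<close> marks the given matrices and \<open>Inr\<close> their adjoints. Since
  \<open>w i\<close> times an adjoint row sum is \<open>w i - d \<nu> i\<close>, every new condition
  reduces to the values 1/2 for the sum of d, 1/6 for the sum of d times a row sum of
  \<open>B\<close>, and 1/3 for the sum of d d'/w, the last being assumption
  \<open>D\<close>.\<close>

lemma order3_conditions_adjoint:
  fixes B :: "'b \<Rightarrow> nat \<Rightarrow> nat \<Rightarrow> real"
  assumes w: "\<And>i. i \<in> {1..s} \<Longrightarrow> w i \<noteq> 0"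
    and B: "order3_conditions s B w"
    and D: "\<And>\<mu> \<nu>. (\<Sum>j=1..s. (\<Sum>i=1..s. w i * B \<mu> i j) * (\<Sum>i=1..s. w i * B \<nu> i j) / w j) = 1 / 3"
  shows "order3_conditions s (case_sum B (\<lambda>\<nu> i j. w j - w j / w i * B \<nu> j i)) w"
proof -
  let ?c = "\<lambda>\<nu>. row_sum s (B \<nu>)" and ?A = "case_sum B (\<lambda>\<nu> i j. w j - w j / w i * B \<nu> j i)"
  define d where "d \<nu> j = (\<Sum>i=1..s. w i * B \<nu> i j)" for \<nu> j
  have C0: "(\<Sum>i=1..s. w i) = 1" and C1: "(\<Sum>i=1..s. w i * ?c \<mu> i) = 1 / 2"
    and C2: "(\<Sum>i=1..s. w i * (?c \<mu> i * ?c \<nu> i)) = 1 / 3"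
    and C3: "(\<Sum>i=1..s. w i * (\<Sum>j=1..s. B \<mu> i j * ?c \<nu> j)) = 1 / 6" for \<mu> \<nu>
    using B by (auto simp: order3_conditions_def)
  have D: "(\<Sum>j=1..s. d \<mu> j * d \<nu> j / w j) = 1 / 3" for \<mu> \<nu>
    using D by (simp add: d_def)
  \<comment> \<open>Pairing \<open>d \<nu>\<close> with \<open>x\<close> amounts to applying
    \<open>B \<nu>\<close> to \<open>x\<close> and weighting with \<open>w\<close>; this turns sums
    over \<open>d\<close> into known conditions.\<close>
  have sum_d: "(\<Sum>j=1..s. d \<nu> j * x j) = (\<Sum>i=1..s. w i * (\<Sum>j=1..s. B \<nu> i j * x j))" for \<nu> x
    unfolding d_def sum_distrib_left sum_distrib_right by (subst sum.swap) (simp only: mult.assoc)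
  have d1: "(\<Sum>j=1..s. d \<nu> j) = 1 / 2" for \<nu>
    using sum_d[of \<nu> "\<lambda>_. 1"] C1[of \<nu>] by (simp add: row_sum_def)
  have wc: "w i * row_sum s (?A (Inr \<nu>)) i = w i - d \<nu> i" if "i \<in> {1..s}" for \<nu> i
  proof -
    have "row_sum s (?A (Inr \<nu>)) i = 1 - d \<nu> i / w i"
      using C0 by (simp add: row_sum_def d_def sum_subtractf sum_divide_distrib)
    then show ?thesis using w[OF that] by (simp add: field_simps)
  qed
  have cc: "w i * (row_sum s (?A (Inr \<mu>)) i * row_sum s (?A (Inr \<nu>)) i)
      = w i - d \<mu> i - d \<nu> i + d \<mu> i * d \<nu> i / w i" if "i \<in> {1..s}" for \<mu> \<nu> i
  proof -
    have "w i * (row_sum s (?A (Inr \<mu>)) i * row_sum s (?A (Inr \<nu>)) i)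
      = (w i * row_sum s (?A (Inr \<mu>)) i) * (w i * row_sum s (?A (Inr \<nu>)) i) / w i"
      using w[OF that] by simp
    then show ?thesis unfolding wc[OF that] using w[OF that] by (simp add: field_simps)
  qed
  have dc: "(\<Sum>j=1..s. d \<nu> j * ?c \<mu> j) = 1 / 6" for \<mu> \<nu>
    unfolding sum_d C3 ..
  have E1: "(\<Sum>i=1..s. w i * row_sum s (?A \<mu>) i) = 1 / 2" for \<mu>
  proof (cases \<mu>)
    case (Inr \<nu>)
    have "(\<Sum>i=1..s. w i * row_sum s (?A \<mu>) i) = (\<Sum>i=1..s. w i - d \<nu> i)"
      unfolding Inr by (intro sum.cong refl wc)
    then show ?thesis using C0 d1 by (simp add: sum_subtractf)
  qed (use C1 in simp)
  have E2': "(\<Sum>i=1..s. w i * (?c \<mu> i * row_sum s (?A (Inr \<nu>)) i)) = 1 / 3" for \<mu> \<nu>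
  proof -
    \<comment> \<open>The value is 1/2 - 1/6.\<close>
    have "(\<Sum>i=1..s. w i * (?c \<mu> i * row_sum s (?A (Inr \<nu>)) i)) = (\<Sum>i=1..s. (w i - d \<nu> i) * ?c \<mu> i)"
      by (intro sum.cong refl) (simp only: wc[symmetric] mult_ac)
    then show ?thesis using C1[of \<mu>] dc[of \<nu> \<mu>] by (simp add: sum_subtractf left_diff_distrib)
  qed
  have E2: "(\<Sum>i=1..s. w i * (row_sum s (?A \<mu>) i * row_sum s (?A \<nu>) i)) = 1 / 3" for \<mu> \<nu>
  proof (cases \<mu>)
    case (Inl \<mu>')
    then show ?thesis using C2 E2' by (cases \<nu>) auto
  next
    case \<mu>: (Inr \<mu>')
    show ?thesis
    proof (cases \<nu>)
      case (Inl \<nu>')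
      then show ?thesis using E2'[of \<nu>' \<mu>'] \<mu> by (simp add: mult_ac)
    next
      case (Inr \<nu>')
      \<comment> \<open>The value is 1 - 1/2 - 1/2 + 1/3.\<close>
      have "(\<Sum>i=1..s. w i * (row_sum s (?A \<mu>) i * row_sum s (?A \<nu>) i))
          = (\<Sum>i=1..s. w i - d \<mu>' i - d \<nu>' i + d \<mu>' i * d \<nu>' i / w i)"
        unfolding Inr \<mu> by (intro sum.cong refl cc)
      then show ?thesis using C0 d1[of \<mu>'] d1[of \<nu>'] D[of \<mu>' \<nu>'] by (simp add: sum_subtractf sum.distrib)
    qed
  qed
  have E3: "(\<Sum>i=1..s. w i * (\<Sum>j=1..s. ?A \<mu> i j * row_sum s (?A \<nu>) j)) = 1 / 6" for \<mu> \<nu>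
  proof (cases \<mu>)
    case (Inl \<mu>')
    show ?thesis
    proof (cases \<nu>)
      case (Inl \<nu>')
      then show ?thesis using C3 \<open>\<mu> = Inl \<mu>'\<close> by simp
    next
      case (Inr \<nu>')
      have "d \<mu>' j * row_sum s (?A \<nu>) j = d \<mu>' j - d \<mu>' j * d \<nu>' j / w j" if "j \<in> {1..s}" for j
      proof -
        have "d \<mu>' j * row_sum s (?A \<nu>) j = d \<mu>' j * (w j * row_sum s (?A (Inr \<nu>')) j) / w j"
          using w[OF that] Inr by simp
        then show ?thesis unfolding wc[OF that] using w[OF that] by (simp add: field_simps)
      qed
      \<comment> \<open>The value is 1/2 - 1/3, the last term again by \<open>D\<close>.\<close>
      then have "(\<Sum>j=1..s. d \<mu>' j * row_sum s (?A \<nu>) j) = (\<Sum>j=1..s. d \<mu>' j - d \<mu>' j * d \<nu>' j / w j)"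
        by (intro sum.cong refl)
      also have "\<dots> = 1 / 6" using d1[of \<mu>'] D[of \<mu>' \<nu>'] by (simp add: sum_subtractf)
      finally show ?thesis by (simp only: Inl sum.case sum_d)
    qed
  next
    case (Inr \<mu>')
    let ?r = "row_sum s (?A \<nu>)"
    \<comment> \<open>Multiplication by \<open>w i\<close> clears the quotient in the adjoint
      matrix. Summing over \<open>i\<close> then turns the transposed entries into row sums of
      \<open>B \<mu>'\<close>, so a chain-tree condition becomes the difference of \<open>E1\<close>
      and a bushy-tree condition \<open>E2\<close>: 1/2 - 1/3.\<close>
    have "w i * (\<Sum>j=1..s. ?A \<mu> i j * ?r j) = w i * (\<Sum>j=1..s. w j * ?r j) - (\<Sum>j=1..s. w j * (B \<mu>' j i * ?r j))"
      if "i \<in> {1..s}" for i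
      using w[OF that] by (simp add: Inr left_diff_distrib sum_subtractf right_diff_distrib sum_distrib_left mult_ac)
    then have "(\<Sum>i=1..s. w i * (\<Sum>j=1..s. ?A \<mu> i j * ?r j))
        = (\<Sum>i=1..s. w i * (\<Sum>j=1..s. w j * ?r j) - (\<Sum>j=1..s. w j * (B \<mu>' j i * ?r j)))"
      by (intro sum.cong refl)
    also have "\<dots> = (\<Sum>i=1..s. w i) * (\<Sum>j=1..s. w j * ?r j) - (\<Sum>j=1..s. w j * (?c \<mu>' j * ?r j))"
      unfolding sum_subtractf sum_distrib_right row_sum_def[of s "B \<mu>'"] sum_distrib_left[of "w _"]
      by (subst (2) sum.swap) (rule refl)
    also have "\<dots> = 1 / 6" using E1[of \<nu>] E2[of "Inl \<mu>'" \<nu>] C0 by simp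
    finally show ?thesis .
  qed
  show ?thesis unfolding order3_conditions_def using C0 E1 E2 E3 by blast
qed

section \<open>Necessity of the order conditions for the IMEX method\<close>

lemma continuous_map_coord: "continuous_map (Euclidean_space N) euclideanreal (\<lambda>x. x k)"
  unfolding Euclidean_space_def
  by (intro continuous_map_from_subtopology continuous_map_product_projection) simp

lemma coord_Ck_const: "coord_Ck N n (\<lambda>x. c)"
proof (induction n arbitrary: c)
  case (Suc n)
  then show ?case by (auto intro!: exI[of _ "\<lambda>_. 0"])
qed simp

text \<open>The factor \<open>c\<close> lets the lemma cover both the linear components of the test
  fields and the partial derivatives of a squared coordinate.\<close>

lemma coord_Ck_coord: "coord_Ck N n (\<lambda>x. c * x k)"
proof (cases n)
  case (Suc m)
  have "\<exists>\<psi>. coord_Ck N m \<psi> \<and> (\<forall>x\<in>RN N. ((\<lambda>\<xi>. c * (x(i := \<xi>)) k) has_real_derivative \<psi> x) (at (x i)))" for i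
    by (rule exI[of _ "\<lambda>_. if i = k then c else 0"], rule conjI[OF coord_Ck_const])
      (auto intro!: derivative_eq_intros)
  then show ?thesis using Suc by (auto intro!: continuous_intros continuous_map_coord continuous_map_real_mult)
qed (auto intro!: continuous_map_coord continuous_map_real_mult)

lemma coord_Ck_coord_square: "coord_Ck N n (\<lambda>x. (x k)\<^sup>2)"
proof (cases n)
  case (Suc m)
  have "\<exists>\<psi>. coord_Ck N m \<psi> \<and> (\<forall>x\<in>RN N. ((\<lambda>\<xi>. ((x(i := \<xi>)) k)\<^sup>2) has_real_derivative \<psi> x) (at (x i)))" for i
    by (rule exI[of _ "\<lambda>x. (if i = k then 2 else 0) * x k"], rule conjI[OF coord_Ck_coord])
      (auto intro!: derivative_eq_intros)
  then show ?thesis using Suc by (auto intro!: continuous_map_coord continuous_map_real_pow)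
qed (auto intro!: continuous_map_coord continuous_map_real_pow)

section \<open>Reading off the order conditions from a test system\<close>

lemma bigo_power_imp_zero:
  assumes "(\<lambda>h::real. h ^ m * c) \<in> O[at_right 0](\<lambda>h. h ^ n)" "m < n"
  shows "c = 0"
proof -
  obtain k where n: "n = m + Suc k" using assms(2) less_iff_Suc_add by auto
  have "bigh n (\<lambda>h. h ^ m * c)" using assms(1) by (simp add: vbigo_def)
  then obtain C where "eventually (\<lambda>h. norm (h ^ m * c) \<le> C * h ^ n) (at_right 0)"
    unfolding bigh_iff by blast
  with eventually_at_right_unit have "eventually (\<lambda>h. norm c \<le> C * h ^ Suc k) (at_right 0)"
  proof eventually_elim
    case (elim h)
    then have "h ^ m * norm c \<le> h ^ m * (C * h ^ Suc k)"
      by (simp add: n norm_mult power_add abs_mult mult_ac)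
    then show ?case using elim(1) by (subst (asm) mult_le_cancel_left_pos) auto
  qed
  from tendsto_unique[OF _ power_bound_tendsto_0[OF this] tendsto_const] show ?thesis by simp
qed

lemma less_4_cases: "k < (4::nat) \<Longrightarrow> k = 0 \<or> k = 1 \<or> k = 2 \<or> k = 3"
  by arith

text \<open>The components of the test system realise the elementary differentials of order one, two and
  three. The stages are explicit, and the error of component \<open>k\<close> is a single power of \<open>h\<close> of degree
  at most three times the defect of an order condition, so it is \<open>O(h\<^sup>4)\<close> only if that defect is zero.\<close>

definition test_F :: "real \<Rightarrow> real \<Rightarrow> (nat \<Rightarrow> real) \<Rightarrow> nat \<Rightarrow> real" where
  "test_F \<alpha> \<gamma> x = (\<lambda>k. if k = 0 then \<alpha> else if k = 1 then \<gamma> * x 0 else if k = 2 then x 1 else if k = 3 then (x 0)\<^sup>2 else 0)"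

definition test_G :: "real \<Rightarrow> real \<Rightarrow> (nat \<Rightarrow> real) \<Rightarrow> nat \<Rightarrow> real" where
  "test_G \<beta> \<delta> x = (\<lambda>k. if k = 0 then \<beta> else if k = 1 then \<delta> * x 0 else 0)"

lemma smooth_field_test_F: "smooth_field 4 (test_F \<alpha> \<gamma>)"
  using coord_Ck_coord[of 4 _ 1 1]
  by (auto simp: smooth_field_def test_F_def topspace_Euclidean_space coord_Ck_const coord_Ck_coord
      coord_Ck_coord_square dest!: less_4_cases)

lemma smooth_field_test_G: "smooth_field 4 (test_G \<beta> \<delta>)"
  by (auto simp: smooth_field_def test_G_def topspace_Euclidean_space coord_Ck_const coord_Ck_coord
      dest!: less_4_cases)

text \<open>The parameters colour the trees: \<open>\<alpha>\<close>, \<open>\<beta>\<close> weigh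
  the explicit and the implicit part at the leaves, \<open>\<gamma>\<close>, \<open>\<delta>\<close>
  at the vertex carrying a single leaf. Values 0 and 1 select a part, and \<open>\<alpha>\<close> =
  \<open>\<beta>\<close> = 1 gives access to mixed products. Here h \<open>c i\<close> and h^2
  \<open>d i\<close> are the first two components of stage \<open>i\<close>.\<close>

lemma imex_order_conditions:
  fixes \<alpha> \<beta> \<gamma> \<delta> :: real
  assumes ord: "imex_order s ta a tw w 3"
  defines "c \<equiv> \<lambda>i. \<alpha> * row_sum s ta i + \<beta> * row_sum s a i"
  defines "d \<equiv> \<lambda>i. \<gamma> * (\<Sum>j=1..s. ta i j * c j) + \<delta> * (\<Sum>j=1..s. a i j * c j)"
  shows "\<alpha> * (\<Sum>i=1..s. tw i) + \<beta> * (\<Sum>i=1..s. w i) = \<alpha> + \<beta>"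
    and "\<gamma> * (\<Sum>i=1..s. tw i * c i) + \<delta> * (\<Sum>i=1..s. w i * c i) = (\<gamma> + \<delta>) * (\<alpha> + \<beta>) / 2"
    and "(\<Sum>i=1..s. tw i * d i) = (\<gamma> + \<delta>) * (\<alpha> + \<beta>) / 6"
    and "(\<Sum>i=1..s. tw i * (c i)\<^sup>2) = (\<alpha> + \<beta>)\<^sup>2 / 3"
proof -
  \<comment> \<open>The exact solution with initial value 0 at time 0, found by integrating one
    component after the other.\<close>
  define y :: "real \<Rightarrow> nat \<Rightarrow> real" where
    "y t k = (if k = 0 then (\<alpha> + \<beta>) * t else if k = 1 then (\<gamma> + \<delta>) * (\<alpha> + \<beta>) / 2 * t ^ 2
      else if k = 2 then (\<gamma> + \<delta>) * (\<alpha> + \<beta>) / 6 * t ^ 3 else if k = 3 then (\<alpha> + \<beta>)\<^sup>2 / 3 * t ^ 3 else 0)" for t k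
  \<comment> \<open>The right-hand side of each component involves only lower components, so the
    stage equations are solved by successive substitution, for the implicit coefficients
    \<open>a\<close> as well.\<close>
  define Y :: "real \<Rightarrow> nat \<Rightarrow> nat \<Rightarrow> real" where
    "Y h i k = (if k = 0 then h * c i else if k = 1 then h ^ 2 * d i
      else if k = 2 then h ^ 3 * (\<Sum>j=1..s. ta i j * d j)
      else if k = 3 then h ^ 3 * (\<Sum>j=1..s. ta i j * (c j)\<^sup>2) else 0)" for h i k
  have y0: "y 0 k = 0" for k by (simp add: y_def)
  have Y_RN: "Y h i \<in> RN 4" for h i by (simp add: Y_def topspace_Euclidean_space)
  have ty: "y t \<in> RN 4" for t by (simp add: y_def topspace_Euclidean_space)
  have der: "((\<lambda>\<tau>. y \<tau> k) has_real_derivative test_F \<alpha> \<gamma> (y t) k + test_G \<beta> \<delta> (y t) k) (at t)" if "k < 4" for k t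
    using less_4_cases[OF that]
    by (auto simp: y_def test_F_def test_G_def power2_eq_square intro!: derivative_eq_intros)
      (auto simp: field_simps)
  have Y0: "Y h i 0 = h * c i" and Y1: "Y h i 1 = h ^ 2 * d i" for h i
    by (simp_all add: Y_def)
  have st: "Y h i k = y 0 k + h * (\<Sum>j=1..s. ta i j * test_F \<alpha> \<gamma> (Y h j) k) + h * (\<Sum>j=1..s. a i j * test_G \<beta> \<delta> (Y h j) k)"
    if "k < 4" for h i k
    using less_4_cases[OF that]
  proof (elim disjE)
    assume "k = 0"
    then show ?thesis
      by (simp add: y0 Y0 test_F_def test_G_def c_def row_sum_def sum_distrib_left sum_distrib_right algebra_simps)
  next
    assume "k = 1"
    then show ?thesis
      by (simp add: y0 Y0 Y1[simplified] test_F_def test_G_def d_def sum_distrib_left power2_eq_square algebra_simps)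
  next
    assume "k = 2"
    then show ?thesis using Y1
      by (simp add: y0 Y_def[of _ _ 2] test_F_def test_G_def sum_distrib_left power2_eq_square power3_eq_cube algebra_simps)
  next
    assume "k = 3"
    then show ?thesis
      by (simp add: y0 Y0 Y_def[of _ _ 3] test_F_def test_G_def sum_distrib_left power2_eq_square power3_eq_cube algebra_simps)
  qed
  have lim: "((\<lambda>h. Y h i k) \<longlongrightarrow> y 0 k) (at_right 0)" if "k < 4" for i k
    using less_4_cases[OF that]
    by (elim disjE) (auto simp: Y_def y0 intro!: tendsto_eq_intros)
  have "(\<lambda>h. (y 0 k + h * (\<Sum>i=1..s. tw i * test_F \<alpha> \<gamma> (Y h i) k)
                             + h * (\<Sum>i=1..s. w i * test_G \<beta> \<delta> (Y h i) k)) - y (0 + h) k)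
                 \<in> O[at_right 0](\<lambda>h. h ^ Suc 3)" if "k < 4" for k
    using ord[unfolded imex_order_def, rule_format, of 4 "test_F \<alpha> \<gamma>" "test_G \<beta> \<delta>" 1 0 y Y k]
      smooth_field_test_F smooth_field_test_G ty der st lim Y_RN that
    by (auto simp: imex_stages_def)
  then have O: "(\<lambda>h. h * (\<Sum>i=1..s. tw i * test_F \<alpha> \<gamma> (Y h i) k)
      + h * (\<Sum>i=1..s. w i * test_G \<beta> \<delta> (Y h i) k) - y h k) \<in> O[at_right 0](\<lambda>h. h ^ 4)" if "k < 4" for k
    using that by (simp add: y0)
  have eq: "h * (\<Sum>i=1..s. tw i * test_F \<alpha> \<gamma> (Y h i) 0) + h * (\<Sum>i=1..s. w i * test_G \<beta> \<delta> (Y h i) 0) - y h 0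
      = h ^ 1 * (\<alpha> * (\<Sum>i=1..s. tw i) + \<beta> * (\<Sum>i=1..s. w i) - (\<alpha> + \<beta>))" for h
    by (simp add: y_def test_F_def test_G_def sum_distrib_left algebra_simps)
  from bigo_power_imp_zero[OF O[of 0, unfolded eq]]
  show "\<alpha> * (\<Sum>i=1..s. tw i) + \<beta> * (\<Sum>i=1..s. w i) = \<alpha> + \<beta>" by simp
  have eq: "h * (\<Sum>i=1..s. tw i * test_F \<alpha> \<gamma> (Y h i) 1) + h * (\<Sum>i=1..s. w i * test_G \<beta> \<delta> (Y h i) 1) - y h 1
      = h ^ 2 * (\<gamma> * (\<Sum>i=1..s. tw i * c i) + \<delta> * (\<Sum>i=1..s. w i * c i) - (\<gamma> + \<delta>) * (\<alpha> + \<beta>) / 2)" for h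
    by (simp add: y_def Y0 test_F_def test_G_def sum_distrib_left power2_eq_square right_diff_distrib distrib_left mult_ac)
  from bigo_power_imp_zero[OF O[of 1, unfolded eq]]
  show "\<gamma> * (\<Sum>i=1..s. tw i * c i) + \<delta> * (\<Sum>i=1..s. w i * c i) = (\<gamma> + \<delta>) * (\<alpha> + \<beta>) / 2" by simp
  have eq: "h * (\<Sum>i=1..s. tw i * test_F \<alpha> \<gamma> (Y h i) 2) + h * (\<Sum>i=1..s. w i * test_G \<beta> \<delta> (Y h i) 2) - y h 2
      = h ^ 3 * ((\<Sum>i=1..s. tw i * d i) - (\<gamma> + \<delta>) * (\<alpha> + \<beta>) / 6)" for h
    using Y1 by (simp add: y_def test_F_def test_G_def sum_distrib_left power2_eq_square power3_eq_cube right_diff_distrib mult_ac)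
  from bigo_power_imp_zero[OF O[of 2, unfolded eq]]
  show "(\<Sum>i=1..s. tw i * d i) = (\<gamma> + \<delta>) * (\<alpha> + \<beta>) / 6" by simp
  have eq: "h * (\<Sum>i=1..s. tw i * test_F \<alpha> \<gamma> (Y h i) 3) + h * (\<Sum>i=1..s. w i * test_G \<beta> \<delta> (Y h i) 3) - y h 3
      = h ^ 3 * ((\<Sum>i=1..s. tw i * (c i)\<^sup>2) - (\<alpha> + \<beta>)\<^sup>2 / 3)" for h
    by (simp add: y_def Y0 test_F_def test_G_def sum_distrib_left power2_eq_square power3_eq_cube right_diff_distrib mult_ac)
  from bigo_power_imp_zero[OF O[of 3, unfolded eq]]
  show "(\<Sum>i=1..s. tw i * (c i)\<^sup>2) = (\<alpha> + \<beta>)\<^sup>2 / 3" by simp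
qed

lemma imex_order_imp_conditions:
  assumes tw: "\<And>i. i \<in> {1..s} \<Longrightarrow> tw i = w i" and ord: "imex_order s ta a tw w 3"
  shows "order3_conditions s (\<lambda>b. if b then ta else a) w"
proof -
  let ?B = "\<lambda>b. if b then ta else a"
  have tw': "(\<Sum>i=1..s. tw i * x i) = (\<Sum>i=1..s. w i * x i)" for x
    by (intro sum.cong refl) (simp add: tw)
  note c = imex_order_conditions[OF ord, unfolded tw']
  \<comment> \<open>The parameter pairs (1, 0) and (0, 1) pick out \<open>ta\<close> and
    \<open>a\<close>; in both cases their sum, which enters the exact solution, is 1.\<close>
  have b: "(if b then 1 else 0) * row_sum s ta i + (if b then 0 else 1) * row_sum s a i = row_sum s (?B b) i"
    "(if b then 1 else 0) + (if b then 0 else 1) = (1::real)" for b i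
    by auto
  have E0: "(\<Sum>i=1..s. w i) = 1"
    using imex_order_conditions(1)[OF ord, of 1 0] tw'[of "\<lambda>_. 1"] by simp
  have E1: "(\<Sum>i=1..s. w i * row_sum s (?B \<mu>) i) = 1 / 2" for \<mu>
    using c(2)[of 1 "if \<mu> then 1 else 0" "if \<mu> then 0 else 1" 0, unfolded b] by simp
  have sq: "(\<Sum>i=1..s. w i * (row_sum s (?B \<mu>) i)\<^sup>2) = 1 / 3" for \<mu>
    using c(4)[of "if \<mu> then 1 else 0" "if \<mu> then 0 else 1", unfolded b] by simp
  \<comment> \<open>Polarization: the square of the sum of the two row sums has weighted sum 4/3,
    and each single square contributes 1/3, which leaves 2/3 for twice the mixed term.\<close>
  have mixed: "(\<Sum>i=1..s. w i * (row_sum s ta i * row_sum s a i)) = 1 / 3"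
  proof -
    have "(\<Sum>i=1..s. w i * (row_sum s ta i + row_sum s a i)\<^sup>2) = 4 / 3"
      using c(4)[of 1 1] by simp
    moreover have "w i * (row_sum s ta i + row_sum s a i)\<^sup>2 = w i * (row_sum s ta i)\<^sup>2 + w i * (row_sum s a i)\<^sup>2
        + 2 * (w i * (row_sum s ta i * row_sum s a i))" for i
      by (simp add: power2_eq_square algebra_simps)
    ultimately show ?thesis using sq[of True] sq[of False]
      by (simp add: sum.distrib flip: sum_distrib_left)
  qed
  have E2: "(\<Sum>i=1..s. w i * (row_sum s (?B \<mu>) i * row_sum s (?B \<nu>) i)) = 1 / 3" for \<mu> \<nu>
    using sq[of \<mu>] mixed by (cases \<mu>; cases \<nu>) (simp_all add: power2_eq_square mult_ac)
  have E3: "(\<Sum>i=1..s. w i * (\<Sum>j=1..s. ?B \<mu> i j * row_sum s (?B \<nu>) j)) = 1 / 6" for \<mu> \<nu>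
    using c(3)[of "if \<mu> then 1 else 0" "if \<nu> then 1 else 0" "if \<nu> then 0 else 1" "if \<mu> then 0 else 1", unfolded b]
    by (cases \<mu>) simp_all
  show ?thesis unfolding order3_conditions_def using E0 E1 E2 E3 by blast
qed

section \<open>The extended system\<close>

text \<open>Rewrites the transposed partial Jacobian through derivatives of \<open>f\<close> on the
  whole product space in the fixed directions \<open>(axis i 1, 0)\<close>. This is the form in
  which \<open>Ck\<close> gives smoothness jointly in all variables.\<close>

lemma jacT_eq:
  fixes f :: "(real ^ 'k) \<times> (real ^ 'm) \<Rightarrow> real ^ 'k"
  assumes "f differentiable (at (y, u))"
  shows "jacT f y u P = (\<Sum>i\<in>UNIV. (frechet_derivative f (at (y, u)) (axis i 1, 0) \<bullet> P) *\<^sub>R axis i 1)"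
proof -
  let ?D = "frechet_derivative f (at (y, u))"
  have "((\<lambda>\<eta>. f (\<eta>, u)) has_derivative (\<lambda>v. ?D (v, 0))) (at y)"
    by (rule has_derivative_compose[where f = "\<lambda>\<eta>. (\<eta>, u)" and g = f])
      (use assms frechet_derivative_works in \<open>auto intro!: derivative_eq_intros\<close>)
  then have "frechet_derivative (\<lambda>\<eta>. f (\<eta>, u)) (at y) = (\<lambda>v. ?D (v, 0))"
    by (rule frechet_derivative_at[symmetric])
  then have "jacT f y u P $ i = ?D (axis i 1, 0) \<bullet> P" for i
    by (simp add: jacT_def jacobian_def matrix_vector_mult_def transpose_def matrix_def inner_vec_def)
  then show ?thesis by (simp add: vec_eq_iff axis_def if_distrib cong: if_cong)
qed

lemma Ck_jacT:
  fixes f :: "(real ^ 'k) \<times> (real ^ 'm) \<Rightarrow> real ^ 'k"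
  assumes f: "Ck (Suc n) f" and "Ck n Y" "Ck n U" "Ck n P"
  shows "Ck n (\<lambda>x. jacT f (Y x) (U x) (P x))"
proof -
  have D: "f differentiable (at z)" for z using Ck_SucD(1)[OF f] unfolding differentiable_def by blast
  show ?thesis unfolding jacT_eq[OF D]
    by (intro Ck_sum Ck_bilinear[OF bounded_bilinear_scaleR] Ck_bilinear[OF bounded_bilinear_inner] Ck_const
        Ck_compose[OF Ck_SucD(2)[OF f]] Ck_Pair assms)
qed

section \<open>The scheme as an additive method with four parts\<close>

lemma sum_UNIV_bool_bool: "(\<Sum>\<nu>\<in>UNIV. g \<nu>) = g (Inl True) + g (Inl False) + (g (Inr True) + g (Inr False))"
  for g :: "bool + bool \<Rightarrow> 'a::comm_monoid_add"
  by (simp add: sum.Plus UNIV_bool add_ac flip: UNIV_Plus_UNIV)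

text \<open>The phase space orders its components as (y, tp, p) but \<open>\<phi>\<close> expects
  (y, p, tp), so the last two projections are interchanged.\<close>

definition control ::
  "((real ^ 'k) \<times> (real ^ 'k) \<times> (real ^ 'k) \<Rightarrow> real ^ 'm) \<Rightarrow> (real ^ 'k) \<times> (real ^ 'k) \<times> (real ^ 'k) \<Rightarrow> real ^ 'm" where
  "control \<phi> z = \<phi> (fst z, snd (snd z), fst (snd z))"

definition costate_field ::
  "((real ^ 'k) \<times> (real ^ 'm) \<Rightarrow> real ^ 'k) \<Rightarrow> ((real ^ 'k) \<times> (real ^ 'm) \<Rightarrow> real ^ 'k) \<Rightarrow>
   ((real ^ 'k) \<times> (real ^ 'k) \<times> (real ^ 'k) \<Rightarrow> real ^ 'm) \<Rightarrow> (real ^ 'k) \<times> (real ^ 'k) \<times> (real ^ 'k) \<Rightarrow> real ^ 'k" where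
  "costate_field f g \<phi> z =
     - jacT f (fst z) (control \<phi> z) (fst (snd z)) - jacT g (fst z) (control \<phi> z) (snd (snd z))"

text \<open>Points of the phase space are triples \<open>(y, tp, p)\<close>. \<open>Inl\<close> marks the two parts of the state
  equation (\<open>True\<close> for \<open>f\<close>), \<open>Inr\<close> the equations for \<open>tp\<close> (\<open>True\<close>) and \<open>p\<close>. The equations for
  \<open>tp\<close> and \<open>p\<close> need not be split further, since \<^const>\<open>alpha_t\<close> and \<^const>\<open>alpha\<close>, and likewise
  \<^const>\<open>beta_t\<close> and \<^const>\<open>beta\<close>, coincide for equal weights.\<close>

definition ext_field ::
  "((real ^ 'k) \<times> (real ^ 'm) \<Rightarrow> real ^ 'k) \<Rightarrow> ((real ^ 'k) \<times> (real ^ 'm) \<Rightarrow> real ^ 'k) \<Rightarrow>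
   ((real ^ 'k) \<times> (real ^ 'k) \<times> (real ^ 'k) \<Rightarrow> real ^ 'm) \<Rightarrow> bool + bool \<Rightarrow>
   (real ^ 'k) \<times> (real ^ 'k) \<times> (real ^ 'k) \<Rightarrow> (real ^ 'k) \<times> (real ^ 'k) \<times> (real ^ 'k)" where
  "ext_field f g \<phi> \<nu> z = (case \<nu> of
      Inl b \<Rightarrow> ((if b then f else g) (fst z, control \<phi> z), 0, 0)
    | Inr b \<Rightarrow> (0, if b then costate_field f g \<phi> z else 0, if b then 0 else costate_field f g \<phi> z))"

lemma Ck_ext_field:
  assumes "smooth f" "smooth g" "smooth \<phi>"
  shows "Ck n (ext_field f g \<phi> \<nu>)"
proof -
  have f: "Ck k f" and g: "Ck k g" and \<phi>: "Ck k \<phi>" for k using assms by (auto simp: smooth_def)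
  note comps = Ck_linear[OF bounded_linear_fst]
    Ck_linear[OF bounded_linear_compose[OF bounded_linear_fst bounded_linear_snd]]
    Ck_linear[OF bounded_linear_compose[OF bounded_linear_snd bounded_linear_snd]]
  have u: "Ck n (control \<phi>)"
    unfolding control_def[abs_def] by (intro Ck_compose[OF \<phi>] Ck_Pair comps)
  have "Ck n (\<lambda>z. (-1) *\<^sub>R jacT f (fst z) (control \<phi> z) (fst (snd z)) + (-1) *\<^sub>R jacT g (fst z) (control \<phi> z) (snd (snd z)))"
    by (intro Ck_add Ck_bilinear[OF bounded_bilinear_scaleR] Ck_const Ck_jacT f g u comps)
  then have c: "Ck n (costate_field f g \<phi>)"
    by (simp add: costate_field_def[abs_def])
  show ?thesis
  proof (cases \<nu>)
    case (Inl b)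
    have "Ck n (\<lambda>z. ((if b then f else g) (fst z, control \<phi> z), 0, 0))"
      by (cases b) (simp_all, (intro Ck_Pair Ck_const Ck_compose[OF f] Ck_compose[OF g] comps u)+)
    then show ?thesis by (simp add: Inl ext_field_def[abs_def])
  next
    case (Inr b)
    have "Ck n (\<lambda>z. (0, if b then costate_field f g \<phi> z else 0, if b then 0 else costate_field f g \<phi> z))"
      by (cases b) (simp_all, (intro Ck_Pair Ck_const c)+)
    then show ?thesis by (simp add: Inr ext_field_def[abs_def])
  qed
qed

text \<open>Stacking state and both costates into triples turns the scheme into one additive method
  on the product space, so a single application of \<open>ark_order3\<close> also handles the
  coupling through the control.\<close>

lemma additive_step_order3:
  fixes f g :: "(real ^ 'k) \<times> (real ^ 'm) \<Rightarrow> real ^ 'k"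
  assumes smooth: "smooth f" "smooth g" "smooth \<phi>"
    and tw: "\<And>i. i \<in> {1..s} \<Longrightarrow> tw i = w i"
    and cond: "order3_conditions s (case_sum (\<lambda>b. if b then ta else a) (\<lambda>b i j. w j - w j / w i * (if b then ta else a) j i)) w"
    and e: "e > 0" and sol: "extended_solution f g \<phi> (ball t0 e) y tp p" and init: "tp t0 = p t0"
    and stages: "eventually (\<lambda>h. additive_stages s ta a tw w f g \<phi> h (y t0) (p t0) (Y h) (tP h) (P h)) (at_right 0)"
    and lim: "\<And>i. i \<in> {1..s} \<Longrightarrow> ((\<lambda>h. Y h i) \<longlongrightarrow> y t0) (at_right 0)"
       "\<And>i. i \<in> {1..s} \<Longrightarrow> ((\<lambda>h. tP h i) \<longlongrightarrow> p t0) (at_right 0)"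
       "\<And>i. i \<in> {1..s} \<Longrightarrow> ((\<lambda>h. P h i) \<longlongrightarrow> p t0) (at_right 0)"
  shows "bigh 4 (\<lambda>h. (state_update s tw w f g \<phi> h (y t0) (Y h) (tP h) (P h) - y (t0 + h),
      costate_update s tw w f g \<phi> h (tp t0) (Y h) (tP h) (P h) - tp (t0 + h),
      costate_update s tw w f g \<phi> h (p t0) (Y h) (tP h) (P h) - p (t0 + h)))"
proof -
  let ?A = "case_sum (\<lambda>b. if b then ta else a) (\<lambda>b i j. w j - w j / w i * (if b then ta else a) j i)"
  define z where "z t = (y t, tp t, p t)" for t
  define Z where "Z h i = (Y h i, tP h i, P h i)" for h i
  have der: "(z has_vector_derivative (\<Sum>\<nu>\<in>UNIV. ext_field f g \<phi> \<nu> (z t))) (at t)" if "t \<in> ball t0 e" for t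
    using sol[unfolded extended_solution_def Let_def, rule_format, OF that]
    unfolding z_def sum_UNIV_bool_bool
    by (auto simp: ext_field_def control_def costate_field_def intro!: has_vector_derivative_Pair)
  have ev: "eventually (\<lambda>h. \<forall>i\<in>{1..s}. Z h i = z t0 + h *\<^sub>R (\<Sum>\<nu>\<in>UNIV. \<Sum>j=1..s. ?A \<nu> i j *\<^sub>R ext_field f g \<phi> \<nu> (Z h j))) (at_right 0)"
    using stages
  proof eventually_elim
    case (elim h)
    show ?case
    proof
      fix i assume i: "i \<in> {1..s}"
      let ?U = "\<lambda>j. \<phi> (Y h j, P h j, tP h j)"
      let ?J = "\<lambda>j. jacT f (Y h j) (?U j) (tP h j)" and ?J' = "\<lambda>j. jacT g (Y h j) (?U j) (P h j)"
      have st: "Y h i = y t0 + h *\<^sub>R (\<Sum>j=1..s. ta i j *\<^sub>R f (Y h j, ?U j)) + h *\<^sub>R (\<Sum>j=1..s. a i j *\<^sub>R g (Y h j, ?U j))"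
        "tP h i = p t0 - h *\<^sub>R (\<Sum>j=1..s. alpha_t ta tw i j *\<^sub>R ?J j) - h *\<^sub>R (\<Sum>j=1..s. alpha ta tw w i j *\<^sub>R ?J' j)"
        "P h i = p t0 - h *\<^sub>R (\<Sum>j=1..s. beta_t a tw w i j *\<^sub>R ?J j) - h *\<^sub>R (\<Sum>j=1..s. beta a w i j *\<^sub>R ?J' j)"
        using elim i unfolding additive_stages_def Let_def by blast+
      \<comment> \<open>With equal weights both matrices in the equation for \<open>tP\<close>
        become the adjoint of \<open>ta\<close>, and both in the equation for \<open>P\<close> the
        adjoint of \<open>a\<close>. The contributions of \<open>f\<close> and \<open>g\<close> then
        merge into one \<open>costate_field\<close> per equation.\<close>
      have tws: "(\<Sum>j=1..s. alpha_t ta tw i j *\<^sub>R x j) = (\<Sum>j=1..s. (w j - w j / w i * ta j i) *\<^sub>R x j)"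
        "(\<Sum>j=1..s. alpha ta tw w i j *\<^sub>R x j) = (\<Sum>j=1..s. (w j - w j / w i * ta j i) *\<^sub>R x j)"
        "(\<Sum>j=1..s. beta_t a tw w i j *\<^sub>R x j) = (\<Sum>j=1..s. (w j - w j / w i * a j i) *\<^sub>R x j)"
        "(\<Sum>j=1..s. beta a w i j *\<^sub>R x j) = (\<Sum>j=1..s. (w j - w j / w i * a j i) *\<^sub>R x j)" for x :: "nat \<Rightarrow> real ^ 'k"
        by (intro sum.cong refl; simp add: alpha_t_def alpha_def beta_t_def beta_def tw tw[OF i])+
      show "Z h i = z t0 + h *\<^sub>R (\<Sum>\<nu>\<in>UNIV. \<Sum>j=1..s. ?A \<nu> i j *\<^sub>R ext_field f g \<phi> \<nu> (Z h j))"
        unfolding sum_UNIV_bool_bool Z_def z_def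
        by (simp add: prod_eq_iff fst_sum snd_sum ext_field_def control_def costate_field_def st[unfolded tws] init
            scaleR_add_right scaleR_diff_right sum_subtractf sum_negf del: One_nat_def)
    qed
  qed
  have Z_lim: "((\<lambda>h. Z h i) \<longlongrightarrow> z t0) (at_right 0)" if "i \<in> {1..s}" for i
    unfolding Z_def z_def init by (intro tendsto_Pair lim that)
  have tws: "(\<Sum>j=1..s. tw j *\<^sub>R x j) = (\<Sum>j=1..s. w j *\<^sub>R x j)" for x :: "nat \<Rightarrow> real ^ 'k"
    by (intro sum.cong refl) (simp add: tw)
  have "z t0 + h *\<^sub>R (\<Sum>\<nu>\<in>UNIV. \<Sum>j=1..s. w j *\<^sub>R ext_field f g \<phi> \<nu> (Z h j)) - z (t0 + h) =
    (state_update s tw w f g \<phi> h (y t0) (Y h) (tP h) (P h) - y (t0 + h),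
      costate_update s tw w f g \<phi> h (tp t0) (Y h) (tP h) (P h) - tp (t0 + h),
      costate_update s tw w f g \<phi> h (p t0) (Y h) (tP h) (P h) - p (t0 + h))" for h
    unfolding sum_UNIV_bool_bool Z_def z_def state_update_def costate_update_def Let_def tws
    by (simp add: prod_eq_iff fst_sum snd_sum ext_field_def control_def costate_field_def
        scaleR_add_right scaleR_diff_right sum_subtractf sum_negf del: One_nat_def)
  with ark_order3[OF Ck_ext_field[OF smooth] cond ev Z_lim e der] show ?thesis by simp
qed

theorem theorem3p1:
  fixes s :: nat
    and ta a :: "nat \<Rightarrow> nat \<Rightarrow> real"
    and tw w :: "nat \<Rightarrow> real"
  assumes "\<And>i. i \<in> {1..s} \<Longrightarrow> tw i \<noteq> 0"
    and "\<And>i. i \<in> {1..s} \<Longrightarrow> w i \<noteq> 0"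
    and "diagonally_implicit s ta a"
    and "\<And>i. i \<in> {1..s} \<Longrightarrow> tw i = w i"
    and "imex_order s ta a tw w 3"
    and "(\<Sum>i=1..s. (coeff_d s ta w i)\<^sup>2 / w i) = 1 / 3"
    and "(\<Sum>i=1..s. (coeff_e s a w i)\<^sup>2 / w i) = 1 / 3"
    and "(\<Sum>i=1..s. coeff_d s ta w i * coeff_e s a w i / w i) = 1 / 3"
  shows "additive_order TYPE('k::finite) TYPE('m::finite) s ta a tw w 3"
proof -
  let ?B = "\<lambda>b. if b then ta else a"
  \<comment> \<open>The three hypotheses cover the four pairs of parts, the mixed one serving for
    both orders.\<close>
  have "(\<Sum>j=1..s. (\<Sum>i=1..s. w i * ?B \<mu> i j) * (\<Sum>i=1..s. w i * ?B \<nu> i j) / w j) = 1 / 3" for \<mu> \<nu>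
    using assms(6-8) by (cases \<mu>; cases \<nu>) (simp_all add: coeff_d_def coeff_e_def power2_eq_square mult.commute)
  from order3_conditions_adjoint[OF assms(2) imex_order_imp_conditions[OF assms(4,5)] this]
  have cond: "order3_conditions s (case_sum ?B (\<lambda>b i j. w j - w j / w i * ?B b j i)) w" .
  show ?thesis
    unfolding additive_order_def
  proof (intro allI impI, elim conjE)
    fix f g :: "(real ^ 'k) \<times> (real ^ 'm) \<Rightarrow> real ^ 'k" and \<phi> :: "(real ^ 'k) \<times> (real ^ 'k) \<times> (real ^ 'k) \<Rightarrow> real ^ 'm"
      and t0 e :: real and y tp p :: "real \<Rightarrow> real ^ 'k" and Y tP P :: "real \<Rightarrow> nat \<Rightarrow> real ^ 'k"
    assume H: "smooth f" "smooth g" "smooth \<phi>" and e: "e > 0" "extended_solution f g \<phi> (ball t0 e) y tp p" "tp t0 = p t0"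
      and st: "\<forall>\<^sub>F h in at_right 0. additive_stages s ta a tw w f g \<phi> h (y t0) (p t0) (Y h) (tP h) (P h)"
      and lim: "\<forall>i\<in>{1..s}. ((\<lambda>h. Y h i) \<longlongrightarrow> y t0) (at_right 0) \<and>
                    ((\<lambda>h. tP h i) \<longlongrightarrow> p t0) (at_right 0) \<and> ((\<lambda>h. P h i) \<longlongrightarrow> p t0) (at_right 0)"
    have "bigh 4 (\<lambda>h. (state_update s tw w f g \<phi> h (y t0) (Y h) (tP h) (P h) - y (t0 + h),
      costate_update s tw w f g \<phi> h (tp t0) (Y h) (tP h) (P h) - tp (t0 + h),
      costate_update s tw w f g \<phi> h (p t0) (Y h) (tP h) (P h) - p (t0 + h)))" (is "bigh 4 ?err")
      by (rule additive_step_order3[OF H assms(4) cond e st]) (use lim in auto)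
    \<comment> \<open>The three separate estimates are the linear projections of the error
      triple.\<close>
    note E = vbigo_linear[OF bounded_linear_fst this]
      vbigo_linear[OF bounded_linear_compose[OF bounded_linear_fst bounded_linear_snd] this]
      vbigo_linear[OF bounded_linear_compose[OF bounded_linear_snd bounded_linear_snd] this]
    show "(\<lambda>h. norm (state_update s tw w f g \<phi> h (y t0) (Y h) (tP h) (P h) - y (t0 + h)))
          \<in> O[at_right 0](\<lambda>h. h ^ Suc 3) \<and>
        (\<lambda>h. norm (costate_update s tw w f g \<phi> h (tp t0) (Y h) (tP h) (P h) - tp (t0 + h)))
          \<in> O[at_right 0](\<lambda>h. h ^ Suc 3) \<and>
        (\<lambda>h. norm (costate_update s tw w f g \<phi> h (p t0) (Y h) (tP h) (P h) - p (t0 + h)))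
          \<in> O[at_right 0](\<lambda>h. h ^ Suc 3)"
      using E by (simp add: vbigo_def)
  qed
qed

end
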